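(* Fix a finite relational language $L$ with all relation symbols of arity at least $2$ and $\overline\alpha:L\to(0,1)\cap\mathbb{Q}$, and let $c$ be as in the context. Let $k\geq0$ be an integer and let $\mathfrak{M}_{k/c}$ be the generic for $(K_{k/c},\leq)$, where $\leq$ is inherited from $K_{\overline\alpha}$. Then $\mathfrak{M}_{k/c}\models S_{\overline\alpha}$ and $\dim(\mathfrak{M}_{k/c})=k/c$.
   Context: $K_L$: finite $L$-structures (including empty) with relations symmetric and irreflexive. $\delta(\mathfrak{A})=|A|-\sum_{E\in L}\overline\alpha(E)N_E(\mathfrak{A})$, $N_E(\mathfrak{A})$ the number of subsets of $A$ on which $E$ holds. $K_{\overline\alpha}=\{\mathfrak{A}\in K_L:\delta(\mathfrak{A}')\geq0\ \forall\mathfrak{A}'\subseteq\mathfrak{A}\}$. $\mathfrak{A}\leq\mathfrak{B}$ (for $\mathfrak{A}\subseteq\mathfrak{B}$) means $\delta(\mathfrak{A})\leq\delta(\mathfrak{A}')$ for all $\mathfrak{A}\subseteq\mathfrak{A}'\subseteq\mathfrak{B}$; for an infinite structure $\mathfrak{M}$ with all finite substructures in $K_L$, finite $\mathfrak{A}\leq\mathfrak{M}$ means $\mathfrak{A}\leq\mathfrak{B}$ for all finite $\mathfrak{A}\subseteq\mathfrak{B}\subseteq\mathfrak{M}$. $c=\mathrm{lcm}\{q_E:E\in L\}$ where $\overline\alpha(E)=p_E/q_E$ in lowest terms. $K_{k/c}=\{\mathfrak{A}\in K_{\overline\alpha}:\delta(\mathfrak{A})=k/c\}$ with $\leq$ inherited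 from $K_{\overline\alpha}$. The generic for $(K_{k/c},\leq)$ is a countable structure $\mathfrak{M}$ all of whose finite substructures lie in $K_{\overline\alpha}$, which is the union of a $\leq$-chain of members of $K_{k/c}$, such that whenever $\mathfrak{A}\leq\mathfrak{B}$ are in $K_{k/c}$ and $\mathfrak{A}\leq\mathfrak{M}$ there is $\mathfrak{B}'\leq\mathfrak{M}$ with $\mathfrak{B}'\cong_{\mathfrak{A}}\mathfrak{B}$, and such that every finite $\mathfrak{A}\subseteq\mathfrak{M}$ is contained in some $\mathfrak{B}\in K_{k/c}$ with $\mathfrak{B}\leq\mathfrak{M}$. $S_{\overline\alpha}$ is the theory axiomatized by: every finite substructure lies in $K_{\overline\alpha}$, and for all $\mathfrak{A}\leq\mathfrak{B}$ in $K_{\overline\alpha}$, every embedding of $\mathfrak{A}$ into the model extends to an embedding of $\mathfrak{B}$. For $\mathfrak{M}\models S_{\overline\alpha}$, $\dim(\mathfrak{M})=\max\{\delta(\mathfrak{B}):\mathfrak{B}\leq\mathfrak{M},\ B\text{ finite}\}$ ($=\infty$ if unbounded). *)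

theory Defs
  imports
    Complex_Main
    "HOL-Library.Multiset"
    "HOL-Library.Countable_Set"
    "HOL-Library.Extended_Real"
    "HOL-Library.Infinite_Typeclass"
begin

text \<open>The relation symbols of the language are the elements of a type \<open>'l\<close>, with arities
  \<open>ar\<close>. Relations are sets of tuples, and tuples are lists.\<close>

record ('a, 'l) fo_structure =
  univ :: "'a set"
  rel :: "'l \<Rightarrow> 'a list set"

definition is_structure :: "('l \<Rightarrow> nat) \<Rightarrow> ('a, 'l) fo_structure \<Rightarrow> bool" where
  "is_structure ar A \<longleftrightarrow> (\<forall>E. \<forall>t\<in>rel A E. length t = ar E \<and> set t \<subseteq> univ A)"

definition symmetric_rels :: "('a, 'l) fo_structure \<Rightarrow> bool" where
  "symmetric_rels A \<longleftrightarrow> (\<forall>E. \<forall>t\<in>rel A E. \<forall>t'. mset t' = mset t \<longrightarrow> t' \<in> rel A E)"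

definition irreflexive_rels :: "('a, 'l) fo_structure \<Rightarrow> bool" where
  "irreflexive_rels A \<longleftrightarrow> (\<forall>E. \<forall>t\<in>rel A E. distinct t)"

text \<open>Substructures are induced, as always in model theory.\<close>

definition substructure :: "('a, 'l) fo_structure \<Rightarrow> ('a, 'l) fo_structure \<Rightarrow> bool" where
  "substructure A B \<longleftrightarrow>
     univ A \<subseteq> univ B \<and> (\<forall>E. rel A E = {t \<in> rel B E. set t \<subseteq> univ A})"

definition embedding :: "('a \<Rightarrow> 'b) \<Rightarrow> ('a, 'l) fo_structure \<Rightarrow> ('b, 'l) fo_structure \<Rightarrow> bool" where
  "embedding f A B \<longleftrightarrow>
     inj_on f (univ A) \<and> f ` univ A \<subseteq> univ B \<and>
     (\<forall>E t. set t \<subseteq> univ A \<longrightarrow> (t \<in> rel A E \<longleftrightarrow> map f t \<in> rel B E))"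

definition isomorphic_over ::
  "('a, 'l) fo_structure \<Rightarrow> ('a, 'l) fo_structure \<Rightarrow> ('a, 'l) fo_structure \<Rightarrow> bool" where
  "isomorphic_over A B B' \<longleftrightarrow>
     (\<exists>f. embedding f B B' \<and> f ` univ B = univ B' \<and> (\<forall>x\<in>univ A. f x = x))"

definition K_L :: "('l \<Rightarrow> nat) \<Rightarrow> ('a, 'l) fo_structure set" where
  "K_L ar = {A. is_structure ar A \<and> finite (univ A) \<and> symmetric_rels A \<and> irreflexive_rels A}"

definition N_holds :: "'l \<Rightarrow> ('a, 'l) fo_structure \<Rightarrow> nat" where
  "N_holds E A = card {X. X \<subseteq> univ A \<and> (\<exists>t\<in>rel A E. set t = X)}"

definition \<delta> :: "('l::finite \<Rightarrow> rat) \<Rightarrow> ('a, 'l) fo_structure \<Rightarrow> rat" where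
  "\<delta> \<alpha> A = of_nat (card (univ A)) - (\<Sum>E\<in>UNIV. \<alpha> E * of_nat (N_holds E A))"

definition K_\<alpha> :: "('l::finite \<Rightarrow> nat) \<Rightarrow> ('l \<Rightarrow> rat) \<Rightarrow> ('a, 'l) fo_structure set" where
  "K_\<alpha> ar \<alpha> = {A \<in> K_L ar. \<forall>A'. substructure A' A \<longrightarrow> 0 \<le> \<delta> \<alpha> A'}"

text \<open>\<open>strong\<close> is the relation \<open>\<le>\<close> between finite structures, \<open>strong_in\<close> its extension to pairs
  of a finite and a possibly infinite structure.\<close>

definition strong :: "('l::finite \<Rightarrow> rat) \<Rightarrow> ('a, 'l) fo_structure \<Rightarrow> ('a, 'l) fo_structure \<Rightarrow> bool" where
  "strong \<alpha> A B \<longleftrightarrow>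
     substructure A B \<and>
     (\<forall>A'. substructure A A' \<and> substructure A' B \<longrightarrow> \<delta> \<alpha> A \<le> \<delta> \<alpha> A')"

definition strong_in :: "('l::finite \<Rightarrow> rat) \<Rightarrow> ('a, 'l) fo_structure \<Rightarrow> ('a, 'l) fo_structure \<Rightarrow> bool" where
  "strong_in \<alpha> A M \<longleftrightarrow>
     finite (univ A) \<and> substructure A M \<and>
     (\<forall>B. finite (univ B) \<and> substructure A B \<and> substructure B M \<longrightarrow> strong \<alpha> A B)"

text \<open>\<open>quotient_of\<close> yields numerator and positive denominator in lowest terms.\<close>

definition common_denom :: "('l::finite \<Rightarrow> rat) \<Rightarrow> int" where
  "common_denom \<alpha> = Lcm (range (\<lambda>E. snd (quotient_of (\<alpha> E))))"

definition K_frac :: "('l::finite \<Rightarrow> nat) \<Rightarrow> ('l \<Rightarrow> rat) \<Rightarrow> nat \<Rightarrow> ('a, 'l) fo_structure set" where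
  "K_frac ar \<alpha> k = {A \<in> K_\<alpha> ar \<alpha>. \<delta> \<alpha> A = of_nat k / of_int (common_denom \<alpha>)}"

definition is_union_of_chain ::
  "('l::finite \<Rightarrow> rat) \<Rightarrow> ('a, 'l) fo_structure set \<Rightarrow> ('a, 'l) fo_structure \<Rightarrow> bool" where
  "is_union_of_chain \<alpha> K M \<longleftrightarrow>
     (\<exists>A :: nat \<Rightarrow> ('a, 'l) fo_structure.
        (\<forall>i. A i \<in> K \<and> strong \<alpha> (A i) (A (Suc i))) \<and>
        univ M = (\<Union>i. univ (A i)) \<and>
        (\<forall>E. rel M E = (\<Union>i. rel (A i) E)))"

text \<open>In the next two definitions the finite structures range over the element type of \<open>M\<close>. That
  type is required to be infinite, so that every finite structure has an isomorphic copy in it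
  (over any given finite set of its elements).\<close>

definition generic ::
  "('l::finite \<Rightarrow> nat) \<Rightarrow> ('l \<Rightarrow> rat) \<Rightarrow> nat \<Rightarrow> ('a::infinite, 'l) fo_structure \<Rightarrow> bool" where
  "generic ar \<alpha> k M \<longleftrightarrow>
     is_structure ar M \<and> countable (univ M) \<and>
     (\<forall>A. finite (univ A) \<and> substructure A M \<longrightarrow> A \<in> K_\<alpha> ar \<alpha>) \<and>
     is_union_of_chain \<alpha> (K_frac ar \<alpha> k) M \<and>
     (\<forall>A\<in>K_frac ar \<alpha> k. \<forall>B\<in>K_frac ar \<alpha> k. strong \<alpha> A B \<and> strong_in \<alpha> A M \<longrightarrow>
        (\<exists>B'. strong_in \<alpha> B' M \<and> isomorphic_over A B B')) \<and>
     (\<forall>A. finite (univ A) \<and> substructure A M \<longrightarrow>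
        (\<exists>B\<in>K_frac ar \<alpha> k. substructure A B \<and> strong_in \<alpha> B M))"

definition models_S ::
  "('l::finite \<Rightarrow> nat) \<Rightarrow> ('l \<Rightarrow> rat) \<Rightarrow> ('a::infinite, 'l) fo_structure \<Rightarrow> bool" where
  "models_S ar \<alpha> M \<longleftrightarrow>
     is_structure ar M \<and>
     (\<forall>A. finite (univ A) \<and> substructure A M \<longrightarrow> A \<in> K_\<alpha> ar \<alpha>) \<and>
     (\<forall>A\<in>K_\<alpha> ar \<alpha>. \<forall>B\<in>K_\<alpha> ar \<alpha>. strong \<alpha> A B \<longrightarrow>
        (\<forall>f :: 'a \<Rightarrow> 'a. embedding f A M \<longrightarrow> (\<exists>g. embedding g B M \<and> (\<forall>x\<in>univ A. g x = f x))))"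

text \<open>\<open>\<delta>\<close> takes values in the multiples of \<open>1 / common_denom \<alpha>\<close>, so the maximum below exists
  whenever the values are bounded (and there are any, as is the case for models).\<close>

definition structure_dim :: "('l::finite \<Rightarrow> rat) \<Rightarrow> ('a, 'l) fo_structure \<Rightarrow> ereal" where
  "structure_dim \<alpha> M =
     (let D = {\<delta> \<alpha> B |B. strong_in \<alpha> B M}
      in if bdd_above D then ereal (of_rat (GREATEST d. d \<in> D)) else \<infinity>)"

end

theory Submission imports Defs begin

text \<open>Given \<open>A \<le> B\<close> and a copy of \<open>A\<close> in the generic structure \<open>M\<close>, put the copy inside some
  \<open>C \<le> M\<close> of predimension \<open>k/c\<close> and form the free amalgam of \<open>B\<close> and \<open>C\<close> over \<open>A\<close>. It contains \<open>C\<close>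
  as a strong substructure, but its predimension may be too large. It therefore suffices to lower the
  predimension to that of \<open>C\<close> by adding vertices and new edges that each contain a new vertex, while
  keeping \<open>C\<close> strong; genericity then realizes the result in \<open>M\<close> over \<open>C\<close>. The predimension is
  lowered by \<open>1/c\<close> at a time: pick a vertex \<open>d\<close> whose adjunction to \<open>C\<close> costs at least \<open>1/c\<close> and
  grow a chain of fresh vertices from it. As \<open>1/c\<close> is a sum of weights modulo 1, the chain can be
  chosen so that the edge weights use up the new vertices and exactly \<open>1/c\<close> of \<open>d\<close>.\<close>

subsection \<open>Hypergraphs\<close>

text \<open>Relations in \<open>K_L\<close> are closed under permuting tuples and contain only
  tuples without repetitions, so a structure there is determined by these sets
  (\<open>K_L_rel_iff\<close>). All counting is done on them.\<close>

definition edges :: "('a, 'l) fo_structure \<Rightarrow> 'l \<Rightarrow> 'a set set" where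
  "edges A E = set ` rel A E"

text \<open>With the set as a separate argument, subsets of one structure can be compared without
  forming induced substructures; \<open>\<delta>_substructure\<close> translates back.\<close>

definition predim :: "('l::finite \<Rightarrow> rat) \<Rightarrow> ('l \<Rightarrow> 'a set set) \<Rightarrow> 'a set \<Rightarrow> rat" where
  "predim \<alpha> H X = of_nat (card X) - (\<Sum>E\<in>UNIV. \<alpha> E * of_nat (card {e \<in> H E. e \<subseteq> X}))"

definition uniform :: "('l \<Rightarrow> nat) \<Rightarrow> 'a set \<Rightarrow> ('l \<Rightarrow> 'a set set) \<Rightarrow> bool" where
  "uniform ar V H \<longleftrightarrow> finite V \<and> (\<forall>E. \<forall>e\<in>H E. e \<subseteq> V \<and> card e = ar E)"

text \<open>The old hypergraph has to be induced in the new one, so no edge is added inside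
  \<open>V\<close>. This keeps the predimension of old sets and later yields a substructure.\<close>

definition extends :: "'a set \<Rightarrow> ('l \<Rightarrow> 'a set set) \<Rightarrow> 'a set \<Rightarrow> ('l \<Rightarrow> 'a set set) \<Rightarrow> bool" where
  "extends V H V' H' \<longleftrightarrow> V \<subseteq> V' \<and> (\<forall>E. H E = {e \<in> H' E. e \<subseteq> V})"

text \<open>\<open>gap \<alpha> H C V {} 0\<close> says that \<open>C\<close> is strong in \<open>V\<close>.\<close>

definition gap :: "('l::finite \<Rightarrow> rat) \<Rightarrow> ('l \<Rightarrow> 'a set set) \<Rightarrow> 'a set \<Rightarrow> 'a set \<Rightarrow> 'a set \<Rightarrow> rat \<Rightarrow> bool" where
  "gap \<alpha> H C V D r \<longleftrightarrow>
     (\<forall>X. C \<subseteq> X \<and> X \<subseteq> V \<and> D \<subseteq> X \<longrightarrow> predim \<alpha> H C + r \<le> predim \<alpha> H X)"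

lemma gapD: "gap \<alpha> H C V D r \<Longrightarrow> C \<subseteq> X \<Longrightarrow> X \<subseteq> V \<Longrightarrow> D \<subseteq> X \<Longrightarrow>
    predim \<alpha> H C + r \<le> predim \<alpha> H X"
  unfolding gap_def by blast

lemma uniform_finite_edges: "uniform ar V H \<Longrightarrow> finite (H E)"
  unfolding uniform_def by (rule finite_subset[of _ "Pow V"]) auto

lemma extends_trans: "extends V H V' H' \<Longrightarrow> extends V' H' V'' H'' \<Longrightarrow> extends V H V'' H''"
  unfolding extends_def by auto

lemma predim_extends:
  assumes "extends V H V' H'" "X \<subseteq> V"
  shows "predim \<alpha> H' X = predim \<alpha> H X"
proof -
  have "{e \<in> H' E. e \<subseteq> X} = {e \<in> H E. e \<subseteq> X}" for E
    using assms unfolding extends_def by auto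
  then show ?thesis unfolding predim_def by simp
qed

text \<open>An edge inside \<open>X\<close> or inside \<open>Y\<close> lies inside the union, and an
  edge inside both lies inside the intersection. Edges of the union that lie in neither set can only
  lower the left-hand side.\<close>

lemma predim_submodular:
  assumes "\<And>E. 0 \<le> \<alpha> E" "finite X" "finite Y"
  shows "predim \<alpha> H (X \<union> Y) + predim \<alpha> H (X \<inter> Y) \<le> predim \<alpha> H X + predim \<alpha> H Y"
proof -
  have "of_nat (card {e \<in> H E. e \<subseteq> X}) + of_nat (card {e \<in> H E. e \<subseteq> Y})
      \<le> (of_nat (card {e \<in> H E. e \<subseteq> X \<union> Y}) + of_nat (card {e \<in> H E. e \<subseteq> X \<inter> Y}) :: rat)" for E
  proof -
    have fin: "finite {e \<in> H E. e \<subseteq> Z}" if "finite Z" for Z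
      using that by (auto intro: finite_subset[of _ "Pow Z"])
    have "card {e \<in> H E. e \<subseteq> X} + card {e \<in> H E. e \<subseteq> Y}
        = card ({e \<in> H E. e \<subseteq> X} \<union> {e \<in> H E. e \<subseteq> Y}) + card ({e \<in> H E. e \<subseteq> X} \<inter> {e \<in> H E. e \<subseteq> Y})"
      using assms by (intro card_Un_Int fin) auto
    moreover have "{e \<in> H E. e \<subseteq> X} \<inter> {e \<in> H E. e \<subseteq> Y} = {e \<in> H E. e \<subseteq> X \<inter> Y}"
      by auto
    moreover have "card ({e \<in> H E. e \<subseteq> X} \<union> {e \<in> H E. e \<subseteq> Y}) \<le> card {e \<in> H E. e \<subseteq> X \<union> Y}"
      using assms by (intro card_mono fin) auto
    ultimately show ?thesis
      unfolding of_nat_add[symmetric] of_nat_le_iff by simp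
  qed
  then have "(\<Sum>E\<in>UNIV. \<alpha> E * of_nat (card {e \<in> H E. e \<subseteq> X})) + (\<Sum>E\<in>UNIV. \<alpha> E * of_nat (card {e \<in> H E. e \<subseteq> Y}))
     \<le> (\<Sum>E\<in>UNIV. \<alpha> E * of_nat (card {e \<in> H E. e \<subseteq> X \<union> Y})) + (\<Sum>E\<in>UNIV. \<alpha> E * of_nat (card {e \<in> H E. e \<subseteq> X \<inter> Y}))"
    unfolding sum.distrib[symmetric] distrib_left[symmetric]
    by (intro sum_mono mult_left_mono assms)
  moreover have "(of_nat (card X) + of_nat (card Y) :: rat) = of_nat (card (X \<union> Y)) + of_nat (card (X \<inter> Y))"
    by (metis assms(2,3) card_Un_Int of_nat_add)
  ultimately show ?thesis unfolding predim_def by linarith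
qed

lemma predim_insert_edge:
  assumes "finite X" "e \<notin> H E"
  shows "predim \<alpha> (H(E := insert e (H E))) X = predim \<alpha> H X - (if e \<subseteq> X then \<alpha> E else 0)"
proof -
  let ?H' = "H(E := insert e (H E))"
  have "card {f \<in> ?H' F. f \<subseteq> X} = card {f \<in> H F. f \<subseteq> X} + (if F = E \<and> e \<subseteq> X then 1 else 0)" for F
  proof -
    have fin: "finite {f \<in> H F. f \<subseteq> X}"
      using assms(1) by (auto intro: finite_subset[of _ "Pow X"])
    have "{f \<in> ?H' F. f \<subseteq> X} =
        (if F = E \<and> e \<subseteq> X then insert e {f \<in> H F. f \<subseteq> X} else {f \<in> H F. f \<subseteq> X})"
      by auto
    then show ?thesis using fin assms(2) by auto
  qed
  then have "(\<Sum>F\<in>UNIV. \<alpha> F * of_nat (card {f \<in> ?H' F. f \<subseteq> X}))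
     = (\<Sum>F\<in>UNIV. \<alpha> F * of_nat (card {f \<in> H F. f \<subseteq> X}) + (if F = E then if e \<subseteq> X then \<alpha> E else 0 else 0))"
    by (intro sum.cong) (auto simp: distrib_left)
  then show ?thesis unfolding predim_def by (simp add: sum.distrib)
qed

lemma predim_isolated:
  assumes "finite X" "\<And>E e. e \<in> H E \<Longrightarrow> e \<inter> F = {}"
  shows "predim \<alpha> H X = predim \<alpha> H (X - F) + of_nat (card (X \<inter> F))"
proof -
  have "{e \<in> H E. e \<subseteq> X} = {e \<in> H E. e \<subseteq> X - F}" for E
    using assms(2) by blast
  moreover have "(of_nat (card X) :: rat) = of_nat (card (X - F)) + of_nat (card (X \<inter> F))"
    using assms(1) card_Int_Diff[of X F] by simp
  ultimately show ?thesis unfolding predim_def by simp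
qed

subsection \<open>Residues of the weights\<close>

lemma common_denom_pos: "0 < common_denom (\<alpha> :: 'l::finite \<Rightarrow> rat)"
proof -
  have "0 \<notin> range (\<lambda>E. snd (quotient_of (\<alpha> E)))"
  proof
    assume "0 \<in> range (\<lambda>E. snd (quotient_of (\<alpha> E)))"
    then obtain E where "snd (quotient_of (\<alpha> E)) = 0" by auto
    then show False using quotient_of_denom_pos'[of "\<alpha> E"] by simp
  qed
  then have "common_denom \<alpha> \<noteq> 0"
    unfolding common_denom_def by (subst Lcm_0_iff) auto
  moreover have "0 \<le> common_denom \<alpha>"
    unfolding common_denom_def by (metis Lcm_int_greater_eq_0)
  ultimately show ?thesis by simp
qed

text \<open>Lowest terms enter here: clearing denominators gives \<open>p * n = z * q\<close>, and
  coprimality of \<open>p\<close> and \<open>q\<close> yields \<open>q dvd n\<close>.\<close>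

lemma common_denom_dvd:
  assumes "\<And>E. \<alpha> E * of_int n \<in> \<int>"
  shows "common_denom \<alpha> dvd n"
  unfolding common_denom_def
proof (intro Lcm_least, clarify)
  fix E
  obtain p q where pq: "quotient_of (\<alpha> E) = (p, q)" by fastforce
  obtain z where z: "\<alpha> E * of_int n = of_int z" using assms Ints_cases by blast
  have q: "q > 0" "coprime p q" "\<alpha> E = of_int p / of_int q"
    using pq quotient_of_denom_pos quotient_of_coprime quotient_of_div by blast+
  then have "(of_int (p * n) :: rat) = of_int (z * q)"
    using z by (simp add: nonzero_divide_eq_eq mult.commute divide_eq_eq)
  then have "p * n = z * q" using of_int_eq_iff by blast
  then have "q dvd p * n" by simp
  moreover have "coprime q p" using q(2) by (simp add: coprime_commute)
  ultimately have "q dvd n" by (simp add: coprime_dvd_mult_right_iff)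
  then show "snd (quotient_of (\<alpha> E)) dvd n" using pq by simp
qed

lemma common_denom_mult: "\<alpha> E * of_int (common_denom \<alpha>) \<in> \<int>"
proof -
  obtain p q where pq: "quotient_of (\<alpha> E) = (p, q)" by fastforce
  have "q dvd common_denom \<alpha>"
    unfolding common_denom_def by (rule dvd_Lcm) (metis pq rangeI snd_conv)
  then obtain m where "common_denom \<alpha> = q * m" ..
  moreover have "q > 0" "\<alpha> E = of_int p / of_int q"
    using pq quotient_of_denom_pos quotient_of_div by blast+
  ultimately have "\<alpha> E * of_int (common_denom \<alpha>) = of_int (p * m)" by simp
  then show ?thesis by (metis Ints_of_int)
qed

text \<open>Predimensions are thus discrete: a strict inequality between two of them leaves room for
  at least 1/c, and an excess can be removed in finitely many steps of size 1/c.\<close>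

lemma predim_mult_common_denom: "predim \<alpha> H X * of_int (common_denom \<alpha>) \<in> \<int>"
proof -
  have "predim \<alpha> H X * of_int (common_denom \<alpha>) = of_nat (card X) * of_int (common_denom \<alpha>)
      - (\<Sum>E\<in>UNIV. of_nat (card {e \<in> H E. e \<subseteq> X}) * (\<alpha> E * of_int (common_denom \<alpha>)))"
    unfolding predim_def left_diff_distrib sum_distrib_right
    by (intro arg_cong2[of _ _ _ _ "(-)"] sum.cong refl) simp
  also have "\<dots> \<in> \<int>"
    by (intro Ints_diff Ints_mult Ints_sum common_denom_mult) auto
  finally show ?thesis .
qed

text \<open>In the rationals modulo 1 the weights generate the cyclic group of 1/c. Sums without
  negative multiplicities reach the whole group because every element has finite order; this matters
  because the list will be turned into edges to be added.\<close>

lemma residue_of_weights: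
  fixes \<alpha> :: "'l::finite \<Rightarrow> rat" and z :: int
  shows "\<exists>es. sum_list (map \<alpha> es) - of_int z / of_int (common_denom \<alpha>) \<in> \<int>"
proof -
  define c where "c = common_denom \<alpha>"
  define G where "G = {x. \<exists>es. sum_list (map \<alpha> es) - x \<in> \<int>}"
  have c: "c > 0" unfolding c_def by (rule common_denom_pos)
  have add: "x + y \<in> G" if "x \<in> G" "y \<in> G" for x y
  proof -
    obtain es fs where "sum_list (map \<alpha> es) - x \<in> \<int>" "sum_list (map \<alpha> fs) - y \<in> \<int>"
      using \<open>x \<in> G\<close> \<open>y \<in> G\<close> unfolding G_def by blast
    then have "(sum_list (map \<alpha> es) - x) + (sum_list (map \<alpha> fs) - y) \<in> \<int>"
      by (rule Ints_add)
    then have "sum_list (map \<alpha> (es @ fs)) - (x + y) \<in> \<int>"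
      by (simp add: algebra_simps)
    then show ?thesis unfolding G_def by blast
  qed
  have int: "of_int n \<in> G" for n
    unfolding G_def by (intro CollectI exI[of _ "[]"]) simp
  have mult_nat: "of_nat n * x \<in> G" if "x \<in> G" for n x
    by (induction n) (use that add int[of 0] in \<open>auto simp: distrib_right\<close>)
  have shift: "y \<in> G" if "x \<in> G" "y - x \<in> \<int>" for x y
  proof -
    obtain n where "y - x = of_int n" using \<open>y - x \<in> \<int>\<close> Ints_cases by blast
    then have "y = x + of_int n" by simp
    then show ?thesis using add[OF \<open>x \<in> G\<close> int] by simp
  qed
  have weight: "\<alpha> E \<in> G" for E
    unfolding G_def by (intro CollectI exI[of _ "[E]"]) simp
  have cG: "of_int c * x \<in> \<int>" if "x \<in> G" for x
  proof -
    obtain es where es: "sum_list (map \<alpha> es) - x \<in> \<int>"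
      using \<open>x \<in> G\<close> unfolding G_def by blast
    have "of_int c * sum_list (map \<alpha> es) \<in> \<int>"
    proof (induction es)
      case (Cons E es)
      then show ?case using common_denom_mult[of \<alpha> E]
        by (simp add: distrib_left c_def mult.commute)
    qed simp
    moreover have "of_int c * (sum_list (map \<alpha> es) - x) \<in> \<int>" using es by simp
    ultimately have "of_int c * sum_list (map \<alpha> es) - of_int c * (sum_list (map \<alpha> es) - x) \<in> \<int>"
      by (rule Ints_diff)
    then show ?thesis by (simp add: algebra_simps)
  qed
  \<comment> \<open>Modulo 1 the order of \<open>x\<close> divides \<open>c\<close>, so
    \<open>- x\<close> agrees with the sum of \<open>c - 1\<close> copies of
    \<open>x\<close>.\<close>
  have uminus: "- x \<in> G" if "x \<in> G" for x
  proof (rule shift)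
    show "of_nat (nat (c - 1)) * x \<in> G" using that by (rule mult_nat)
    have "- x - of_nat (nat (c - 1)) * x = - (of_int c * x)"
      using c by (simp add: algebra_simps)
    then show "- x - of_nat (nat (c - 1)) * x \<in> \<int>" using cG[OF that] by simp
  qed
  have mult: "of_int n * x \<in> G" if "x \<in> G" for n x
  proof (cases "n \<ge> 0")
    case True
    then show ?thesis using mult_nat[OF that, of "nat n"] by simp
  next
    case False
    then show ?thesis using mult_nat[OF uminus[OF that], of "nat (- n)"] by simp
  qed
  \<comment> \<open>The aim is that the least positive numerator \<open>g\<close> over
    \<open>c\<close> occurring in \<open>G\<close> is 1. Division with remainder shows that
    \<open>g\<close> divides all numerators that occur.\<close>
  define P where "P n \<longleftrightarrow> n > 0 \<and> of_nat n / of_int c \<in> G" for n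
  have "P (nat c)" unfolding P_def using c int[of 1] by simp
  then obtain g where g: "P g" and least: "\<And>n. P n \<Longrightarrow> g \<le> n"
    using LeastI[of P] Least_le[of P] by blast
  have dvd: "int g dvd w" if "of_int w / of_int c \<in> G" for w
  proof (rule ccontr)
    assume "\<not> int g dvd w"
    then have "w mod int g \<noteq> 0" by (simp add: dvd_eq_mod_eq_0)
    moreover have "0 \<le> w mod int g" "w mod int g < int g"
      using g unfolding P_def by auto
    moreover have "of_int (w mod int g) / of_int c \<in> G"
    proof -
      have "w mod int g = w + (- (w div int g)) * int g"
        by (simp add: minus_div_mult_eq_mod [symmetric])
      then have "of_int (w mod int g) / of_int c =
         of_int w / of_int c + of_int (- (w div int g)) * (of_nat g / of_int c :: rat)"
        by (simp add: add_divide_distrib diff_divide_distrib)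
      then show ?thesis using add[OF that mult] g unfolding P_def by metis
    qed
    ultimately have "P (nat (w mod int g))" unfolding P_def by simp
    then show False using least \<open>w mod int g < int g\<close> \<open>0 \<le> w mod int g\<close> by fastforce
  qed
  have "int g dvd c" using dvd[of c] c int[of 1] by simp
  then obtain c' where c': "c = int g * c'" ..
  \<comment> \<open>All weights are multiples of \<open>g / c\<close>, that is of
    \<open>1 / c'\<close>. Hence \<open>c'\<close> is a common denominator, and minimality of
    \<open>c\<close> forces \<open>g = 1\<close>.\<close>
  have "\<alpha> E * of_int c' \<in> \<int>" for E
  proof -
    obtain w where w: "\<alpha> E * of_int c = of_int w"
      using common_denom_mult Ints_cases unfolding c_def by blast
    then have "of_int w / of_int c = \<alpha> E" using c by (simp add: field_simps)
    then have "int g dvd w" using dvd weight by simp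
    then obtain v where "w = int g * v" ..
    then have "\<alpha> E * of_int c' = of_int v"
      using w c' g unfolding P_def by simp
    then show ?thesis by simp
  qed
  then have "c dvd c'" unfolding c_def by (rule common_denom_dvd)
  then have "int g dvd 1" using c' c by auto
  then have "g = 1" by simp
  then have "of_int z * (1 / of_int c) \<in> G"
    using g unfolding P_def by (intro mult) simp
  then show ?thesis unfolding G_def c_def by simp
qed

subsection \<open>Lowering the predimension\<close>

locale sparse_weights =
  fixes ar :: "'l::finite \<Rightarrow> nat" and \<alpha> :: "'l \<Rightarrow> rat"
  assumes arity: "2 \<le> ar E" and weight_pos: "0 < \<alpha> E" and weight_less_1: "\<alpha> E < 1"
begin

text \<open>A weight is a positive integer multiple of 1/c. This allows \<open>gap_new_point\<close>
  to be applied with \<open>r\<close> equal to 1/c.\<close>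

lemma inverse_common_denom_le: "1 / of_int (common_denom \<alpha>) \<le> \<alpha> E"
proof -
  obtain z where z: "\<alpha> E * of_int (common_denom \<alpha>) = of_int z"
    using common_denom_mult Ints_cases by blast
  have c: "(0::rat) < of_int (common_denom \<alpha>)" using common_denom_pos by simp
  then have "(0::rat) < of_int z" using weight_pos[of E] z[symmetric] by simp
  then have "(1::rat) \<le> of_int z" by simp
  then show ?thesis using c z by (simp add: divide_le_eq)
qed

section \<open>Adding a single edge or a single vertex\<close>

text \<open>Sets without \<open>d\<close> do not contain \<open>e\<close> and keep their
  predimension; sets with \<open>d\<close> have slack \<open>r\<close> and lose at most
  \<open>\<alpha> E\<close>. As \<open>e\<close> is not inside \<open>C\<close>, the value at
  \<open>C\<close> stays fixed.\<close>

lemma gap_insert_edge: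
  assumes V: "finite V" "C \<subseteq> V"
    and gap0: "gap \<alpha> H C V {} 0" and gap: "gap \<alpha> H C V {d} r"
    and e: "d \<in> e" "e \<notin> H E" "\<not> e \<subseteq> C" and r: "\<alpha> E \<le> r"
  defines "H' \<equiv> H(E := insert e (H E))"
  shows "gap \<alpha> H' C V {} 0" "gap \<alpha> H' C V {d} (r - \<alpha> E)"
proof -
  have pre: "predim \<alpha> H' X = predim \<alpha> H X - (if e \<subseteq> X then \<alpha> E else 0)" if "X \<subseteq> V" for X
    unfolding H'_def using that V(1) e(2) by (intro predim_insert_edge) (auto intro: finite_subset)
  have C: "predim \<alpha> H' C = predim \<alpha> H C"
    using pre[OF V(2)] e(3) by simp
  have ge: "predim \<alpha> H C + r \<le> predim \<alpha> H X" if "C \<subseteq> X" "X \<subseteq> V" "d \<in> X" for X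
    using gapD[OF gap] that by simp
  have ge0: "predim \<alpha> H C \<le> predim \<alpha> H X" if "C \<subseteq> X" "X \<subseteq> V" for X
    using gapD[OF gap0] that by fastforce
  show "gap \<alpha> H' C V {} 0" unfolding gap_def
  proof (intro allI impI)
    fix X assume X: "C \<subseteq> X \<and> X \<subseteq> V \<and> {} \<subseteq> X"
    show "predim \<alpha> H' C + 0 \<le> predim \<alpha> H' X"
    proof (cases "e \<subseteq> X")
      case True
      then show ?thesis using ge[of X] X e(1) r pre[of X] C by auto
    next
      case False
      then show ?thesis using ge0[of X] X pre[of X] C by simp
    qed
  qed
  show "gap \<alpha> H' C V {d} (r - \<alpha> E)" unfolding gap_def
  proof (intro allI impI)
    fix X assume X: "C \<subseteq> X \<and> X \<subseteq> V \<and> {d} \<subseteq> X"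
    then show "predim \<alpha> H' C + (r - \<alpha> E) \<le> predim \<alpha> H' X"
      using ge[of X] pre[of X] C weight_pos[of E] by (simp split: if_splits)
  qed
qed

text \<open>Let a set contain \<open>x\<close>. If it contains \<open>e\<close> too, it pays
  \<open>r\<close> for \<open>d\<close> and \<open>1 - \<alpha> E\<close> for \<open>x\<close>.
  Otherwise \<open>x\<close> is isolated in it and costs 1, which is enough because
  \<open>r \<le> \<alpha> E\<close>. The total predimension and the gap grow by the same amount, so
  their difference is an invariant.\<close>

lemma gap_new_point:
  assumes V: "uniform ar V H" "C \<subseteq> V"
    and gap0: "gap \<alpha> H C V {} 0" and gap: "gap \<alpha> H C V {d} r"
    and e: "d \<in> e" "e \<subseteq> V" and x: "x \<notin> V" and r: "0 \<le> r" "r \<le> \<alpha> E"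
  defines "H' \<equiv> H(E := insert (insert x e) (H E))"
  shows "gap \<alpha> H' C (insert x V) {} 0" "gap \<alpha> H' C (insert x V) {x} (r + 1 - \<alpha> E)"
    "predim \<alpha> H' (insert x V) = predim \<alpha> H V + 1 - \<alpha> E"
proof -
  have fin: "finite (insert x V)" using V(1) unfolding uniform_def by simp
  have iso: "f \<inter> {x} = {}" if "f \<in> H F" for f F
    using that V(1) x unfolding uniform_def by blast
  then have new: "insert x e \<notin> H E" by blast
  have pre: "predim \<alpha> H' X = predim \<alpha> H X - (if insert x e \<subseteq> X then \<alpha> E else 0)"
    if "X \<subseteq> insert x V" for X
    unfolding H'_def 
    using finite_subset[OF that fin] new by (intro predim_insert_edge)
  have pre_x: "predim \<alpha> H X = predim \<alpha> H (X - {x}) + 1" if "X \<subseteq> insert x V" "x \<in> X" for X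
    using predim_isolated[where H = H and X = X and F = "{x}" and \<alpha> = \<alpha>]
      finite_subset[OF that(1) fin] iso that(2) by simp
  have C: "predim \<alpha> H' C = predim \<alpha> H C"
    using pre[of C] x V(2) by (simp add: subset_insertI2) blast
  have ge: "predim \<alpha> H C + (r + 1 - \<alpha> E) \<le> predim \<alpha> H' X"
    if X: "C \<subseteq> X" "X \<subseteq> insert x V" "x \<in> X" for X
  proof (cases "insert x e \<subseteq> X")
    case True
    then have "predim \<alpha> H C + r \<le> predim \<alpha> H (X - {x})"
      using X x V(2) e by (intro gapD[OF gap]) auto
    then show ?thesis using True pre[OF X(2)] pre_x[OF X(2,3)] by simp
  next
    case False
    then have "predim \<alpha> H C + 0 \<le> predim \<alpha> H (X - {x})"
      using X x V(2) by (intro gapD[OF gap0]) auto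
    then show ?thesis using False pre[OF X(2)] pre_x[OF X(2,3)] r
      by (simp only: if_False)
  qed
  show "gap \<alpha> H' C (insert x V) {x} (r + 1 - \<alpha> E)"
    unfolding gap_def C using ge by simp
  show "gap \<alpha> H' C (insert x V) {} 0" unfolding gap_def
  proof (intro allI impI)
    fix X assume X: "C \<subseteq> X \<and> X \<subseteq> insert x V \<and> {} \<subseteq> X"
    show "predim \<alpha> H' C + 0 \<le> predim \<alpha> H' X"
    proof (cases "x \<in> X")
      case True
      then show ?thesis using ge[of X] X C r weight_less_1[of E] by simp
    next
      case False
      then show ?thesis using gapD[OF gap0, of X] X pre[of X] C by auto
    qed
  qed
  show "predim \<alpha> H' (insert x V) = predim \<alpha> H V + 1 - \<alpha> E"
    using pre[of "insert x V"] pre_x[of "insert x V"] e(2) x by auto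
qed

text \<open>Fix \<open>d\<close> and \<open>m - 2\<close> further vertices. Completing them by one
  more vertex gives \<open>card V - m + 1\<close> different candidates, more than the members of
  \<open>A\<close> that contain \<open>d\<close>.\<close>

lemma unused_edge:
  assumes V: "finite V" "d \<in> V" and m: "2 \<le> m" and A: "finite A"
    and card: "card {e \<in> A. d \<in> e} + m \<le> card V"
  obtains e where "e \<subseteq> V" "d \<in> e" "card e = m" "e \<notin> A"
proof -
  have "m - 2 \<le> card (V - {d})" using V card by simp
  then obtain B where B: "B \<subseteq> V - {d}" "card B = m - 2"
    by (meson obtain_subset_with_card_n)
  have finB: "finite B" using B V finite_subset by blast
  define F where "F = V - {d} - B"
  have "card F = card V - 1 - (m - 2)"
    unfolding F_def using B V finB by (simp add: card_Diff_subset)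
  then have "card {e \<in> A. d \<in> e} < card F" using card m by linarith
  moreover have inj: "inj_on (\<lambda>f. insert d (insert f B)) F"
  proof (rule inj_onI)
    fix f g assume fg: "f \<in> F" "g \<in> F" "insert d (insert f B) = insert d (insert g B)"
    then have "f \<in> insert d (insert g B)" by blast
    then show "f = g" using fg(1) unfolding F_def by simp
  qed
  ultimately have "\<exists>f\<in>F. insert d (insert f B) \<notin> A"
    using A card_inj_on_le[OF inj, of "{e \<in> A. d \<in> e}"] by fastforce
  then obtain f where f: "f \<in> F" "insert d (insert f B) \<notin> A" by blast
  show thesis
  proof (rule that)
    show "card (insert d (insert f B)) = m"
    proof -
      have "d \<notin> insert f B" "f \<notin> B" using f B unfolding F_def by auto
      then show ?thesis using B(2) finB m by simp
    qed
  qed (use f B V in \<open>auto simp: F_def\<close>)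
qed

text \<open>Attach the relation symbols of \<open>es\<close> one after the other to \<open>d\<close>. If the remaining gap
  \<open>r\<close> is too small, a fresh vertex that takes up the rest of the weight plays the role
  of \<open>d\<close> from then on. Either way \<open>r\<close> decreases by the weight modulo 1 and
  \<open>predim \<alpha> H V - r\<close> does not change. As \<open>d\<close> is not in \<open>V0\<close>, no edge is added inside \<open>V0\<close>.\<close>

lemma exhaust_gap:
  fixes H :: "'l \<Rightarrow> 'a::infinite set set"
  assumes C: "C \<subseteq> V0"
  shows "uniform ar V H \<Longrightarrow> extends V0 H0 V H \<Longrightarrow> d \<in> V - V0 \<Longrightarrow>
    gap \<alpha> H C V {} 0 \<Longrightarrow> gap \<alpha> H C V {d} r \<Longrightarrow> 0 \<le> r \<Longrightarrow> r \<le> 1 \<Longrightarrow> (es = [] \<Longrightarrow> r < 1) \<Longrightarrow>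
    sum_list (map \<alpha> es) - r \<in> \<int> \<Longrightarrow>
    (\<And>E. card {e \<in> H E. d \<in> e} \<le> n) \<Longrightarrow> (\<And>E. n + length es + ar E \<le> card V) \<Longrightarrow>
    \<exists>V' H'. uniform ar V' H' \<and> extends V0 H0 V' H' \<and> gap \<alpha> H' C V' {} 0 \<and>
      predim \<alpha> H' V' = predim \<alpha> H V - r"
proof (induction es arbitrary: V H d r n)
  case Nil
  \<comment> \<open>For the empty list \<open>r\<close> is an integer, and the extra hypothesis
    excludes the value 1, so \<open>r\<close> is 0. A gap of exactly 1 can occur only at the start:
    either kind of step leaves a gap below 1.\<close>
  then obtain z :: int where "r = of_int z"
    by (metis Ints_cases Ints_minus list.simps(8) minus_diff_eq diff_0_right sum_list.Nil)
  then have "r = 0" using Nil.prems(6) Nil.prems(8) by simp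
  then show ?case using Nil.prems by (intro exI[of _ V] exI[of _ H]) simp
next
  case (Cons E es)
  have fin: "finite V" using Cons.prems(1) unfolding uniform_def by blast
  have CV: "C \<subseteq> V" using C Cons.prems(2) unfolding extends_def by blast
  have d: "d \<in> V" "d \<notin> V0" using Cons.prems(3) by auto
  have card: "n + Suc (length es) + ar F \<le> card V" for F using Cons.prems(11)[of F] by simp
  have sum: "\<alpha> E + sum_list (map \<alpha> es) - r \<in> \<int>" using Cons.prems(9) by simp
  show ?case
  proof (cases "\<alpha> E \<le> r")
    case True
    have "card {e \<in> H E. d \<in> e} + ar E \<le> card V"
      using Cons.prems(10)[of E] card[of E] by linarith
    then obtain e where e: "e \<subseteq> V" "d \<in> e" "card e = ar E" "e \<notin> H E"
      using unused_edge[OF fin d(1) arity uniform_finite_edges[OF Cons.prems(1)]] by metis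
    define H' where "H' = H(E := insert e (H E))"
    have "\<exists>V'' H''. uniform ar V'' H'' \<and> extends V0 H0 V'' H'' \<and> gap \<alpha> H'' C V'' {} 0 \<and>
      predim \<alpha> H'' V'' = predim \<alpha> H' V - (r - \<alpha> E)"
    proof (rule Cons.IH)
      show "uniform ar V H'"
        using Cons.prems(1) e unfolding uniform_def H'_def by auto
      show "extends V0 H0 V H'"
        using Cons.prems(2) e(2) d(2) unfolding extends_def H'_def by auto
      show "gap \<alpha> H' C V {} 0" "gap \<alpha> H' C V {d} (r - \<alpha> E)"
        using gap_insert_edge[OF fin CV Cons.prems(4,5) e(2,4) _ True] e(2) d(2) C
        unfolding H'_def by blast+
      show "sum_list (map \<alpha> es) - (r - \<alpha> E) \<in> \<int>" using sum by (simp add: algebra_simps)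
      \<comment> \<open>One symbol of the list has been traded for one edge at \<open>d\<close>. The
        sum in the size condition is unchanged, so \<open>unused_edge\<close> remains
        applicable.\<close>
      show "card {e \<in> H' F. d \<in> e} \<le> Suc n" for F
      proof -
        have "{f \<in> H' F. d \<in> f} \<subseteq> insert e {f \<in> H F. d \<in> f}" unfolding H'_def by auto
        moreover have finF: "finite {f \<in> H F. d \<in> f}"
          using uniform_finite_edges[OF Cons.prems(1)] by simp
        ultimately have "card {f \<in> H' F. d \<in> f} \<le> card (insert e {f \<in> H F. d \<in> f})"
          by (intro card_mono) auto
        also have "\<dots> \<le> Suc (card {f \<in> H F. d \<in> f})" using finF by (simp add: card_insert_if)
        finally show ?thesis using Cons.prems(10)[of F] by linarith
      qed
      show "Suc n + length es + ar F \<le> card V" for F using card[of F] by simp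
    qed (use Cons.prems(3,7) True weight_pos[of E] in auto)
    moreover have "predim \<alpha> H' V = predim \<alpha> H V - \<alpha> E"
      unfolding H'_def using predim_insert_edge[of V e H E \<alpha>] fin e by simp
    ultimately show ?thesis by simp
  next
    case False
    obtain x where x: "x \<notin> V" using ex_new_if_finite[OF infinite_UNIV fin] by blast
    have "ar E - 2 \<le> card (V - {d})" using card[of E] d fin by simp
    then obtain B where B: "B \<subseteq> V - {d}" "card B = ar E - 2"
      by (meson obtain_subset_with_card_n)
    define e where "e = insert d B"
    have finB: "finite B" using B fin finite_subset by blast
    have e: "d \<in> e" "e \<subseteq> V" "card (insert x e) = ar E"
    proof -
      have "x \<notin> insert d B" "d \<notin> B" using B x d by auto
      then have "card (insert x e) = Suc (Suc (card B))"
        unfolding e_def using finB by simp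
      then show "card (insert x e) = ar E" using B arity[of E] by simp
    qed (use B d in \<open>auto simp: e_def\<close>)
    define H' where "H' = H(E := insert (insert x e) (H E))"
    have no: "x \<notin> f" if "f \<in> H F" for f F
      using that x Cons.prems(1) unfolding uniform_def by blast
    note new = gap_new_point[OF Cons.prems(1) CV Cons.prems(4,5) e(1,2) x Cons.prems(6), of E]
    have "\<exists>V'' H''. uniform ar V'' H'' \<and> extends V0 H0 V'' H'' \<and> gap \<alpha> H'' C V'' {} 0 \<and>
      predim \<alpha> H'' V'' = predim \<alpha> H' (insert x V) - (r + 1 - \<alpha> E)"
    proof (rule Cons.IH)
      show "uniform ar (insert x V) H'"
        using Cons.prems(1) e unfolding uniform_def H'_def by auto
      show "extends V0 H0 (insert x V) H'"
        using Cons.prems(2) x unfolding extends_def H'_def by auto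
      show "x \<in> insert x V - V0" using x Cons.prems(2) unfolding extends_def by blast
      show "gap \<alpha> H' C (insert x V) {} 0" "gap \<alpha> H' C (insert x V) {x} (r + 1 - \<alpha> E)"
        using new(1,2) False unfolding H'_def by simp_all
      have "sum_list (map \<alpha> es) - (r + 1 - \<alpha> E) = (\<alpha> E + sum_list (map \<alpha> es) - r) - 1" by simp
      then show "sum_list (map \<alpha> es) - (r + 1 - \<alpha> E) \<in> \<int>" using sum by (metis Ints_1 Ints_diff)
      show "card {f \<in> H' F. x \<in> f} \<le> Suc n" for F
      proof -
        have "{f \<in> H' F. x \<in> f} \<subseteq> {insert x e}" unfolding H'_def using no by auto
        then have "card {f \<in> H' F. x \<in> f} \<le> card {insert x e}" by (intro card_mono) auto
        then show ?thesis by simp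
      qed
      show "Suc n + length es + ar F \<le> card (insert x V)" for F using card[of F] x fin by simp
    qed (use False Cons.prems(6) weight_less_1[of E] in auto)
    moreover have "predim \<alpha> H' (insert x V) = predim \<alpha> H V + 1 - \<alpha> E"
      using new(3) False unfolding H'_def by simp
    ultimately show ?thesis by simp
  qed
qed

text \<open>A vertex outside a maximal set of the same predimension as \<open>C\<close> has a positive gap over
  \<open>C\<close>, by submodularity.\<close>

lemma exists_gap:
  assumes V: "finite V" "C \<subseteq> V" and gap0: "gap \<alpha> H C V {} 0" and less: "predim \<alpha> H C < predim \<alpha> H V"
  obtains d where "d \<in> V" "gap \<alpha> H C V {d} (1 / of_int (common_denom \<alpha>))"
proof -
  define T where "T = {Y. C \<subseteq> Y \<and> Y \<subseteq> V \<and> predim \<alpha> H Y = predim \<alpha> H C}"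
  have "finite T" unfolding T_def using V(1) by (auto intro: finite_subset[of _ "Pow V"])
  moreover have "C \<in> T" using V(2) unfolding T_def by simp
  ultimately obtain Y where "Y \<in> T" and max: "\<forall>Z\<in>T. Y \<subseteq> Z \<longrightarrow> Y = Z"
    using finite_has_maximal[of T] by auto
  then have Y: "Y \<in> T" "C \<subseteq> Y" "Y \<subseteq> V" "predim \<alpha> H Y = predim \<alpha> H C"
    unfolding T_def by auto
  have "Y \<noteq> V" using Y less by auto
  then obtain d where d: "d \<in> V" "d \<notin> Y" using Y by auto
  have "gap \<alpha> H C V {d} (1 / of_int (common_denom \<alpha>))" unfolding gap_def
  proof (intro allI impI)
    fix X assume X: "C \<subseteq> X \<and> X \<subseteq> V \<and> {d} \<subseteq> X"
    have fin: "finite X" "finite Y" using X Y V(1) finite_subset by blast+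
    have "predim \<alpha> H C < predim \<alpha> H X"
    proof (rule ccontr)
      assume "\<not> predim \<alpha> H C < predim \<alpha> H X"
      moreover have "predim \<alpha> H (X \<union> Y) + predim \<alpha> H (X \<inter> Y) \<le> predim \<alpha> H X + predim \<alpha> H Y"
        using fin weight_pos by (intro predim_submodular) (auto intro: less_imp_le)
      \<comment> \<open>Both sets have predimension at least that of \<open>C\<close>, while their
        sum is at most twice that value. So the union would belong to \<open>T\<close> and contain
        \<open>d\<close>, against maximality of \<open>Y\<close>.\<close>
      moreover have "predim \<alpha> H C + 0 \<le> predim \<alpha> H (X \<inter> Y)" "predim \<alpha> H C + 0 \<le> predim \<alpha> H (X \<union> Y)"
        using X Y by (intro gapD[OF gap0]; auto)+
      ultimately have "X \<union> Y \<in> T" using X Y unfolding T_def by auto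
      then have "Y = X \<union> Y" using max by simp
      then show False using X d by auto
    qed
    moreover have c: "(0::rat) < of_int (common_denom \<alpha>)" using common_denom_pos by simp
    ultimately have less: "predim \<alpha> H C * of_int (common_denom \<alpha>) < predim \<alpha> H X * of_int (common_denom \<alpha>)"
      by (rule mult_strict_right_mono)
    obtain v where v: "predim \<alpha> H X * of_int (common_denom \<alpha>) = of_int v"
      using predim_mult_common_denom Ints_cases by blast
    obtain w where w: "predim \<alpha> H C * of_int (common_denom \<alpha>) = of_int w"
      using predim_mult_common_denom Ints_cases by blast
    \<comment> \<open>Both predimensions are integers over c, so the strict inequality improves to a
      difference of 1/c.\<close>
    have "w + 1 \<le> v" using less unfolding v w by simp
    then have "of_int (w + 1) \<le> (of_int v :: rat)" unfolding of_int_le_iff .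
    then have "predim \<alpha> H C * of_int (common_denom \<alpha>) + 1 \<le> predim \<alpha> H X * of_int (common_denom \<alpha>)"
      unfolding v w by simp
    then show "predim \<alpha> H C + 1 / of_int (common_denom \<alpha>) \<le> predim \<alpha> H X"
      using c by (simp add: field_simps)
  qed
  then show thesis using that d by blast
qed

section \<open>From a loss of 1/c to the predimension of \<open>C\<close>\<close>

text \<open>The vertex \<open>d\<close> from \<open>exists_gap\<close> lies in \<open>V\<close>, so
  edges attached to it could fall inside \<open>V\<close>. A fresh \<open>x\<close> is therefore
  joined to \<open>d\<close> first. This raises the predimension by \<open>1 - \<alpha> E\<close>
  and gives \<open>x\<close> the gap \<open>1/c + 1 - \<alpha> E\<close>; exhausting that gap leaves
  a net loss of 1/c. The bound \<open>N\<close> does not depend on the hypergraph, so the step can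
  be iterated.\<close>

lemma extend_step:
  "\<exists>N. \<forall>C V (H :: 'l \<Rightarrow> 'a::infinite set set). uniform ar V H \<longrightarrow> C \<subseteq> V \<longrightarrow> gap \<alpha> H C V {} 0 \<longrightarrow>
     predim \<alpha> H C < predim \<alpha> H V \<longrightarrow> N \<le> card V \<longrightarrow>
     (\<exists>V' H'. uniform ar V' H' \<and> extends V H V' H' \<and> gap \<alpha> H' C V' {} 0 \<and>
       predim \<alpha> H' V' = predim \<alpha> H V - 1 / of_int (common_denom \<alpha>))"
proof -
  define c where "c = common_denom \<alpha>"
  have c: "c > 0" unfolding c_def by (rule common_denom_pos)
  \<comment> \<open>An arbitrary symbol, which will label the edge joining the fresh vertex to
    \<open>d\<close>.\<close>
  define E :: 'l where "E = undefined"
  obtain z where "\<alpha> E * of_int c = of_int z"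
    using common_denom_mult Ints_cases unfolding c_def by blast
  then have z: "\<alpha> E = of_int z / of_int c" using c by (simp add: field_simps)
  \<comment> \<open>The list \<open>E # es\<close> has to match the gap at \<open>x\<close>, which
    is \<open>1/c - \<alpha> E\<close> modulo 1. The leading \<open>E\<close> makes the list
    nonempty, as \<open>exhaust_gap\<close> demands for a gap of 1. So \<open>es\<close> needs the
    residue \<open>1/c - 2 * \<alpha> E\<close>, which is \<open>(1 - 2 * z) / c\<close>.\<close>
  obtain es where "sum_list (map \<alpha> es) - of_int (1 - 2 * z) / of_int c \<in> \<int>"
    using residue_of_weights unfolding c_def by blast
  also have "sum_list (map \<alpha> es) - of_int (1 - 2 * z) / of_int c
      = sum_list (map \<alpha> (E # es)) - (1 / of_int c - \<alpha> E)"
    by (simp add: z diff_divide_distrib)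
  finally have "sum_list (map \<alpha> (E # es)) - (1 / of_int c - \<alpha> E) \<in> \<int>" .
  then have "sum_list (map \<alpha> (E # es)) - (1 / of_int c - \<alpha> E) - 1 \<in> \<int>"
    by (rule Ints_diff) simp
  then have es: "sum_list (map \<alpha> (E # es)) - (1 / of_int c + 1 - \<alpha> E) \<in> \<int>"
    by (simp add: algebra_simps)
  \<comment> \<open>The 2 accounts for the edge already at \<open>x\<close> (\<open>n = 1\<close>)
    and for the leading symbol of \<open>E # es\<close>.\<close>
  define N where "N = 2 + length es + Max (range ar)"
  have ar: "ar F \<le> Max (range ar)" for F by simp
  show ?thesis unfolding c_def[symmetric]
  proof (intro exI[of _ N] allI impI)
    fix C V and H :: "'l \<Rightarrow> 'a set set"
    assume uni: "uniform ar V H" and C: "C \<subseteq> V" and gap0: "gap \<alpha> H C V {} 0"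
      and less: "predim \<alpha> H C < predim \<alpha> H V" and N: "N \<le> card V"
    have fin: "finite V" using uni unfolding uniform_def by blast
    obtain d where d: "d \<in> V" "gap \<alpha> H C V {d} (1 / of_int c)"
      using exists_gap[OF fin C gap0 less] unfolding c_def by blast
    obtain x where x: "x \<notin> V" using ex_new_if_finite[OF infinite_UNIV fin] by blast
    have "ar E - 2 \<le> card V - 1" using N ar[of E] unfolding N_def by linarith
    then have "ar E - 2 \<le> card (V - {d})" using d fin by simp
    then obtain B where B: "B \<subseteq> V - {d}" "card B = ar E - 2"
      by (meson obtain_subset_with_card_n)
    define e where "e = insert d B"
    have finB: "finite B" using B fin finite_subset by blast
    have e: "d \<in> e" "e \<subseteq> V" "card (insert x e) = ar E"
    proof -
      have "x \<notin> insert d B" "d \<notin> B" using B x d by auto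
      then have "card (insert x e) = Suc (Suc (card B))"
        unfolding e_def using finB by simp
      then show "card (insert x e) = ar E" using B arity[of E] by simp
    qed (use B d in \<open>auto simp: e_def\<close>)
    define H' where "H' = H(E := insert (insert x e) (H E))"
    have no: "x \<notin> f" if "f \<in> H F" for f F
      using that x uni unfolding uniform_def by blast
    have le: "1 / of_int c \<le> \<alpha> E" unfolding c_def by (rule inverse_common_denom_le)
    have pos: "(0::rat) \<le> 1 / of_int c" using c by simp
    have r: "0 \<le> 1 / of_int c + 1 - \<alpha> E" "1 / of_int c + 1 - \<alpha> E \<le> 1"
      using pos le weight_less_1[of E] by linarith+
    note new = gap_new_point[OF uni C gap0 d(2) e(1,2) x pos le]
    have "\<exists>V'' H''. uniform ar V'' H'' \<and> extends V H V'' H'' \<and> gap \<alpha> H'' C V'' {} 0 \<and>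
      predim \<alpha> H'' V'' = predim \<alpha> H' (insert x V) - (1 / of_int c + 1 - \<alpha> E)"
    proof (rule exhaust_gap[OF C, where es = "E # es" and n = 1 and d = x])
      show "uniform ar (insert x V) H'"
        using uni e unfolding uniform_def H'_def by auto
      show "extends V H (insert x V) H'"
        using x uni unfolding extends_def uniform_def H'_def by auto
      show "gap \<alpha> H' C (insert x V) {} 0" "gap \<alpha> H' C (insert x V) {x} (1 / of_int c + 1 - \<alpha> E)"
        using new unfolding H'_def by simp_all
      show "card {f \<in> H' F. x \<in> f} \<le> 1" for F
      proof -
        have "{f \<in> H' F. x \<in> f} \<subseteq> {insert x e}" unfolding H'_def using no by auto
        then have "card {f \<in> H' F. x \<in> f} \<le> card {insert x e}" by (intro card_mono) auto
        then show ?thesis by simp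
      qed
      show "1 + length (E # es) + ar F \<le> card (insert x V)" for F
      proof -
        have "1 + length (E # es) + ar F \<le> Suc (card V)"
          using N ar[of F] unfolding N_def list.size by linarith
        then show ?thesis using x fin by simp
      qed
    qed (use x es r in simp_all)
    moreover have "predim \<alpha> H' (insert x V) = predim \<alpha> H V + 1 - \<alpha> E"
      using new(3) unfolding H'_def by simp
    ultimately show "\<exists>V' H'. uniform ar V' H' \<and> extends V H V' H' \<and> gap \<alpha> H' C V' {} 0 \<and>
       predim \<alpha> H' V' = predim \<alpha> H V - 1 / of_int c" by simp
  qed
qed

text \<open>To reach the size that \<open>extend_step\<close> asks for, \<open>V\<close> is first
  padded with isolated vertices; they raise the predimension but keep \<open>C\<close> strong. The
  excess over \<open>C\<close> is then \<open>m / c\<close> for a natural number \<open>m\<close>,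
  and \<open>m\<close> steps remove it.\<close>

lemma extend_to_predim:
  fixes H :: "'l \<Rightarrow> 'a::infinite set set"
  assumes uni: "uniform ar V H" and C: "C \<subseteq> V" and gap0: "gap \<alpha> H C V {} 0"
  shows "\<exists>V' H'. uniform ar V' H' \<and> extends V H V' H' \<and> gap \<alpha> H' C V' {} 0 \<and>
    predim \<alpha> H' V' = predim \<alpha> H C"
proof -
  define c where "c = common_denom \<alpha>"
  have c: "c > 0" unfolding c_def by (rule common_denom_pos)
  obtain N where N: "\<And>C V (H :: 'l \<Rightarrow> 'a set set). uniform ar V H \<Longrightarrow> C \<subseteq> V \<Longrightarrow>
     gap \<alpha> H C V {} 0 \<Longrightarrow> predim \<alpha> H C < predim \<alpha> H V \<Longrightarrow> N \<le> card V \<Longrightarrow>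
     \<exists>V' H'. uniform ar V' H' \<and> extends V H V' H' \<and> gap \<alpha> H' C V' {} 0 \<and>
       predim \<alpha> H' V' = predim \<alpha> H V - 1 / of_int c"
    using extend_step unfolding c_def by meson
  have large: "\<exists>V' H'. uniform ar V' H' \<and> extends V H V' H' \<and> gap \<alpha> H' C V' {} 0 \<and>
      predim \<alpha> H' V' = predim \<alpha> H C"
    if "uniform ar V H" "C \<subseteq> V" "gap \<alpha> H C V {} 0" "N \<le> card V"
      "predim \<alpha> H V = predim \<alpha> H C + of_nat m / of_int c" for V m and H :: "'l \<Rightarrow> 'a set set"
    using that
  proof (induction m arbitrary: V H)
    case 0
    then show ?case by (intro exI[of _ V] exI[of _ H]) (auto simp: extends_def uniform_def)
  next
    case (Suc m)
    have "predim \<alpha> H C < predim \<alpha> H V" using Suc.prems(5) c by simp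
    then obtain V' H' where V': "uniform ar V' H'" "extends V H V' H'" "gap \<alpha> H' C V' {} 0"
      "predim \<alpha> H' V' = predim \<alpha> H V - 1 / of_int c"
      using N Suc.prems by meson
    have sub: "V \<subseteq> V'" using V'(2) unfolding extends_def by blast
    have C': "predim \<alpha> H' C = predim \<alpha> H C" using predim_extends V'(2) Suc.prems(2) by blast
    have "predim \<alpha> H' V' = predim \<alpha> H' C + of_nat m / of_int c"
      unfolding V'(4) Suc.prems(5) C' by (simp add: add_divide_distrib)
    moreover have "N \<le> card V'"
      using Suc.prems(4) card_mono[OF _ sub] V'(1) unfolding uniform_def by fastforce
    ultimately obtain V'' H'' where "uniform ar V'' H''" "extends V' H' V'' H''"
      "gap \<alpha> H'' C V'' {} 0" "predim \<alpha> H'' V'' = predim \<alpha> H' C"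
      using Suc.IH[of V' H'] V' Suc.prems(2) sub by blast
    then show ?case using C' extends_trans[OF V'(2)] by metis
  qed
  have fin: "finite V" using uni unfolding uniform_def by blast
  have "infinite (UNIV - V)" using fin infinite_UNIV by (metis Diff_infinite_finite)
  then obtain F where F: "finite F" "card F = N" "F \<subseteq> UNIV - V"
    by (metis infinite_arbitrarily_large)
  let ?W = "V \<union> F"
  have pre: "predim \<alpha> H X = predim \<alpha> H (X - F) + of_nat (card (X \<inter> F))" if "X \<subseteq> ?W" for X
    using finite_subset[OF that] fin F uni unfolding uniform_def
    by (intro predim_isolated) blast+
  have uniW: "uniform ar ?W H" and ext: "extends V H ?W H"
    using uni F(1) unfolding uniform_def extends_def by auto
  have gapW: "gap \<alpha> H C ?W {} 0" unfolding gap_def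
  proof (intro allI impI)
    fix X assume X: "C \<subseteq> X \<and> X \<subseteq> ?W \<and> {} \<subseteq> X"
    have "predim \<alpha> H C + 0 \<le> predim \<alpha> H (X - F)"
      using X C F by (intro gapD[OF gap0]) auto
    then show "predim \<alpha> H C + 0 \<le> predim \<alpha> H X" using pre[of X] X by simp
  qed
  have "predim \<alpha> H C + 0 \<le> predim \<alpha> H ?W" using C by (intro gapD[OF gapW]) auto
  moreover have c0: "(0::rat) < of_int c" using c by simp
  ultimately have le: "predim \<alpha> H C * of_int c \<le> predim \<alpha> H ?W * of_int c" by simp
  obtain v where v: "predim \<alpha> H ?W * of_int c = of_int v"
    using predim_mult_common_denom Ints_cases unfolding c_def by blast
  obtain w where w: "predim \<alpha> H C * of_int c = of_int w"
    using predim_mult_common_denom Ints_cases unfolding c_def by blast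
  have "w \<le> v" using le unfolding v w by simp
  then obtain m where m: "v = w + int m" by (metis zle_iff_zadd)
  have "predim \<alpha> H ?W * of_int c = (predim \<alpha> H C + of_nat m / of_int c) * of_int c"
    unfolding v m using c0 w by (simp add: distrib_right)
  then have "predim \<alpha> H ?W = predim \<alpha> H C + of_nat m / of_int c"
    using c0 by simp
  moreover have "N \<le> card ?W" using card_mono[of ?W F] F fin by simp
  ultimately obtain V' H' where "uniform ar V' H'" "extends ?W H V' H'" "gap \<alpha> H' C V' {} 0"
      "predim \<alpha> H' V' = predim \<alpha> H C"
    using large[OF uniW _ gapW] C by blast
  then show ?thesis using extends_trans[OF ext] by metis
qed

end

subsection \<open>Structures as hypergraphs\<close>

definition induced :: "('a, 'l) fo_structure \<Rightarrow> 'a set \<Rightarrow> ('a, 'l) fo_structure" where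
  "induced M X = \<lparr>univ = X, rel = \<lambda>E. {t \<in> rel M E. set t \<subseteq> X}\<rparr>"

text \<open>Taking every enumeration of an edge makes the relations symmetric and irreflexive by
  construction. On uniform hypergraphs \<open>edges\<close> undoes this.\<close>

definition of_hypergraph :: "'a set \<Rightarrow> ('l \<Rightarrow> 'a set set) \<Rightarrow> ('a, 'l) fo_structure" where
  "of_hypergraph V H = \<lparr>univ = V, rel = \<lambda>E. {t. distinct t \<and> set t \<in> H E}\<rparr>"

lemma univ_induced [simp]: "univ (induced M X) = X"
  unfolding induced_def by simp

lemma univ_of_hypergraph [simp]: "univ (of_hypergraph V H) = V"
  unfolding of_hypergraph_def by simp

lemma rel_of_hypergraph [simp]: "rel (of_hypergraph V H) E = {t. distinct t \<and> set t \<in> H E}"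
  unfolding of_hypergraph_def by simp

lemma substructure_induced: "X \<subseteq> univ M \<Longrightarrow> substructure (induced M X) M"
  unfolding substructure_def induced_def by simp

lemma substructure_into_induced:
  "substructure A M \<Longrightarrow> univ A \<subseteq> X \<Longrightarrow> substructure A (induced M X)"
  unfolding substructure_def induced_def by auto

lemma extends_substructure:
  "substructure A B \<Longrightarrow> extends (univ A) (edges A) (univ B) (edges B)"
  unfolding substructure_def extends_def edges_def by auto

lemma \<delta>_eq_predim: "\<delta> \<alpha> A = predim \<alpha> (edges A) (univ A)"
proof -
  have "{X. X \<subseteq> univ A \<and> (\<exists>t\<in>rel A E. set t = X)} = {e \<in> edges A E. e \<subseteq> univ A}" for E
    unfolding edges_def by auto
  then show ?thesis unfolding \<delta>_def predim_def N_holds_def by simp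
qed

lemma \<delta>_substructure: "substructure A B \<Longrightarrow> \<delta> \<alpha> A = predim \<alpha> (edges B) (univ A)"
  unfolding \<delta>_eq_predim using predim_extends[OF extends_substructure] by fastforce

text \<open>Every set between the two universes carries an induced substructure, so quantifying over
  intermediate structures amounts to quantifying over sets.\<close>

lemma strong_iff_gap:
  assumes "substructure A B"
  shows "strong \<alpha> A B \<longleftrightarrow> gap \<alpha> (edges B) (univ A) (univ B) {} 0"
proof
  assume strong: "strong \<alpha> A B"
  show "gap \<alpha> (edges B) (univ A) (univ B) {} 0" unfolding gap_def
  proof (intro allI impI)
    fix X assume X: "univ A \<subseteq> X \<and> X \<subseteq> univ B \<and> {} \<subseteq> X"
    then have "substructure A (induced B X)" "substructure (induced B X) B"
      using assms by (simp_all add: substructure_into_induced substructure_induced)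
    moreover from this have "\<delta> \<alpha> A \<le> \<delta> \<alpha> (induced B X)"
      using strong unfolding strong_def by blast
    ultimately show "predim \<alpha> (edges B) (univ A) + 0 \<le> predim \<alpha> (edges B) X"
      using \<delta>_substructure[OF assms, of \<alpha>] \<delta>_substructure[of "induced B X" B \<alpha>] by simp
  qed
next
  assume gap: "gap \<alpha> (edges B) (univ A) (univ B) {} 0"
  show "strong \<alpha> A B" unfolding strong_def
  proof (intro conjI assms allI impI)
    fix A' assume A': "substructure A A' \<and> substructure A' B"
    then have "predim \<alpha> (edges B) (univ A) + 0 \<le> predim \<alpha> (edges B) (univ A')"
      by (intro gapD[OF gap]) (auto simp: substructure_def)
    then show "\<delta> \<alpha> A \<le> \<delta> \<alpha> A'" using A' assms \<delta>_substructure[of _ B \<alpha>] by simp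
  qed
qed

lemma K_L_uniform: "A \<in> K_L ar \<Longrightarrow> uniform ar (univ A) (edges A)"
  unfolding K_L_def uniform_def edges_def is_structure_def irreflexive_rels_def
  by (auto simp: distinct_card)

text \<open>Two lists without repetitions and with the same elements are permutations of each other,
  so symmetry carries membership from one to the other.\<close>

lemma K_L_rel_iff:
  assumes "A \<in> K_L ar"
  shows "t \<in> rel A E \<longleftrightarrow> distinct t \<and> set t \<in> edges A E"
proof
  assume "t \<in> rel A E"
  then show "distinct t \<and> set t \<in> edges A E"
    using assms unfolding K_L_def irreflexive_rels_def edges_def by auto
next
  assume t: "distinct t \<and> set t \<in> edges A E"
  then obtain u where u: "u \<in> rel A E" "set u = set t" unfolding edges_def by auto
  then have "distinct u" using assms unfolding K_L_def irreflexive_rels_def by auto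
  then have "mset t = mset u" using t u(2) set_eq_iff_mset_eq_distinct by blast
  then show "t \<in> rel A E" using assms u(1) unfolding K_L_def symmetric_rels_def by blast
qed

lemma edges_of_hypergraph:
  assumes "uniform ar V H"
  shows "edges (of_hypergraph V H) = H"
proof (intro ext set_eqI iffI)
  fix E e assume e: "e \<in> H E"
  then have "finite e" using assms unfolding uniform_def by (meson finite_subset)
  then obtain t where "set t = e" "distinct t" using finite_distinct_list by blast
  then show "e \<in> edges (of_hypergraph V H) E" using e unfolding edges_def by auto
qed (auto simp: edges_def)

lemma of_hypergraph_K_L:
  assumes "uniform ar V H"
  shows "of_hypergraph V H \<in> K_L ar"
proof -
  have "length t = ar E \<and> set t \<subseteq> V" if "distinct t" "set t \<in> H E" for t E
    using that assms distinct_card[OF that(1)] unfolding uniform_def by fastforce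
  then have "is_structure ar (of_hypergraph V H)"
    unfolding is_structure_def by auto
  moreover have "symmetric_rels (of_hypergraph V H)"
    unfolding symmetric_rels_def
  proof (intro allI ballI impI)
    fix E t t' assume t: "t \<in> rel (of_hypergraph V H) E" and eq: "mset t' = mset t"
    show "t' \<in> rel (of_hypergraph V H) E"
      using t mset_eq_setD[OF eq] mset_eq_imp_distinct_iff[OF eq] by simp
  qed
  moreover have "irreflexive_rels (of_hypergraph V H)"
    unfolding irreflexive_rels_def by simp
  moreover have "finite V" using assms unfolding uniform_def by blast
  ultimately show ?thesis unfolding K_L_def by simp
qed

lemma K_\<alpha>_iff: "A \<in> K_\<alpha> ar \<alpha> \<longleftrightarrow> A \<in> K_L ar \<and> (\<forall>X \<subseteq> univ A. 0 \<le> predim \<alpha> (edges A) X)"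
proof -
  have "0 \<le> predim \<alpha> (edges A) X"
    if "\<forall>A'. substructure A' A \<longrightarrow> 0 \<le> \<delta> \<alpha> A'" "X \<subseteq> univ A" for X
    using that(1) substructure_induced[OF that(2)] \<delta>_substructure[OF substructure_induced[OF that(2)]]
    by (metis univ_induced)
  moreover have "0 \<le> \<delta> \<alpha> A'"
    if "\<forall>X \<subseteq> univ A. 0 \<le> predim \<alpha> (edges A) X" "substructure A' A" for A'
    using that(1) \<delta>_substructure[OF that(2)] that(2) unfolding substructure_def by simp
  ultimately show ?thesis unfolding K_\<alpha>_def by blast
qed

section \<open>Embeddings\<close>

lemma embedding_edges_iff:
  assumes emb: "embedding f A B" and e: "e \<subseteq> univ A"
  shows "e \<in> edges A E \<longleftrightarrow> f ` e \<in> edges B E"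
proof
  assume "e \<in> edges A E"
  then obtain t where "t \<in> rel A E" "set t = e" unfolding edges_def by auto
  then have "map f t \<in> rel B E" "set (map f t) = f ` e"
    using emb e unfolding embedding_def by auto
  then show "f ` e \<in> edges B E" unfolding edges_def by blast
next
  assume "f ` e \<in> edges B E"
  then obtain u where u: "u \<in> rel B E" "set u = f ` e" unfolding edges_def by auto
  \<comment> \<open>The tuple in \<open>B\<close> is pulled back entrywise along the inverse of
    \<open>f\<close> on \<open>e\<close>.\<close>
  define t where "t = map (inv_into e f) u"
  have inj: "inj_on f e" using emb e inj_on_subset unfolding embedding_def by blast
  have "set t = e" unfolding t_def using u(2) inj by (simp add: inv_into_image_cancel)
  moreover have "map f t = u"
    unfolding t_def map_map by (rule map_idI) (use u(2) in \<open>simp add: f_inv_into_f\<close>)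
  ultimately have "t \<in> rel A E" using emb e u(1) unfolding embedding_def by auto
  then show "e \<in> edges A E" using \<open>set t = e\<close> unfolding edges_def by blast
qed

lemma embedding_mono:
  assumes "embedding f A B" "substructure B M"
  shows "embedding f A M"
proof -
  have "map f t \<in> rel B E \<longleftrightarrow> map f t \<in> rel M E" if "set t \<subseteq> univ A" for t E
  proof -
    have "set (map f t) \<subseteq> univ B" using that assms(1) unfolding embedding_def by auto
    then show ?thesis using assms(2) unfolding substructure_def by simp
  qed
  then show ?thesis using assms unfolding embedding_def substructure_def by auto
qed

lemma embedding_into:
  assumes "embedding f A M" "substructure B M" "f ` univ A \<subseteq> univ B"
  shows "embedding f A B"
proof -
  have "map f t \<in> rel B E \<longleftrightarrow> map f t \<in> rel M E" if "set t \<subseteq> univ A" for t E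
  proof -
    have "set (map f t) \<subseteq> univ B" using that assms(3) by auto
    then show ?thesis using assms(2) unfolding substructure_def by simp
  qed
  then show ?thesis using assms unfolding embedding_def by auto
qed

lemma embedding_comp:
  assumes "embedding f A B" "embedding g B M"
  shows "embedding (g \<circ> f) A M"
proof -
  have "t \<in> rel A E \<longleftrightarrow> map (g \<circ> f) t \<in> rel M E" if "set t \<subseteq> univ A" for t E
  proof -
    have "set (map f t) \<subseteq> univ B" using that assms(1) unfolding embedding_def by auto
    then have "map f t \<in> rel B E \<longleftrightarrow> map g (map f t) \<in> rel M E"
      using assms(2) unfolding embedding_def by blast
    then show ?thesis using that assms(1) unfolding embedding_def by simp
  qed
  moreover have "inj_on (g \<circ> f) (univ A)"
    using assms unfolding embedding_def by (meson comp_inj_on inj_on_subset)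
  moreover have "(g \<circ> f) ` univ A \<subseteq> univ M"
    using assms unfolding embedding_def by fastforce
  ultimately show ?thesis unfolding embedding_def by blast
qed

lemma embedding_of_edges:
  assumes "A \<in> K_L ar" "B \<in> K_L ar" "inj_on f (univ A)" "f ` univ A \<subseteq> univ B"
    and edges: "\<And>E e. e \<subseteq> univ A \<Longrightarrow> e \<in> edges A E \<longleftrightarrow> f ` e \<in> edges B E"
  shows "embedding f A B"
proof -
  have "t \<in> rel A E \<longleftrightarrow> map f t \<in> rel B E" if t: "set t \<subseteq> univ A" for t E
  proof -
    have "distinct (map f t) \<longleftrightarrow> distinct t"
      using inj_on_subset[OF assms(3) t] by (simp add: distinct_map)
    then show ?thesis
      using K_L_rel_iff[OF assms(1)] K_L_rel_iff[OF assms(2)] edges[OF t] by simp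
  qed
  then show ?thesis using assms(3,4) unfolding embedding_def by blast
qed

subsection \<open>Free amalgamation\<close>

text \<open>\<open>B\<close> is glued to \<open>C\<close> along \<open>A\<close>, the rest of
  \<open>B\<close> being moved to fresh points. A set above \<open>C\<close> consists of
  \<open>C\<close> and the image of some \<open>Y\<close> between \<open>A\<close> and
  \<open>B\<close>. There are no further edges, so its predimension exceeds that of \<open>C\<close>
  by \<delta>(Y) - \<delta>(A), which is nonnegative because \<open>A\<close> is strong in
  \<open>B\<close>.\<close>

lemma free_amalgam:
  fixes A B C :: "('a::infinite, 'l::finite) fo_structure"
  assumes B: "B \<in> K_L ar" and C: "C \<in> K_L ar" and strong: "strong \<alpha> A B" and emb: "embedding f A C"
  obtains V H g where "uniform ar V H" "extends (univ C) (edges C) V H"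
    "gap \<alpha> H (univ C) V {} 0" "embedding g B (of_hypergraph V H)" "\<And>x. x \<in> univ A \<Longrightarrow> g x = f x"
proof -
  have sub: "substructure A B" using strong unfolding strong_def by blast
  note uniB = K_L_uniform[OF B] and uniC = K_L_uniform[OF C]
  have fin: "finite (univ B)" "finite (univ C)" using uniB uniC unfolding uniform_def by auto
  have AB: "univ A \<subseteq> univ B" using sub unfolding substructure_def by blast
  have edgesA: "edges A E = {e \<in> edges B E. e \<subseteq> univ A}" for E
    using extends_substructure[OF sub] unfolding extends_def by blast
  have infinite: "infinite (UNIV - univ C)" using fin(2) infinite_UNIV by (metis Diff_infinite_finite)
  then obtain F where F: "finite F" "card F = card (univ B - univ A)" "F \<subseteq> UNIV - univ C"
    by (metis infinite_arbitrarily_large)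
  then obtain h where h: "bij_betw h (univ B - univ A) F"
    by (metis fin(1) finite_Diff finite_same_card_bij)
  define g where "g x = (if x \<in> univ A then f x else h x)" for x
  have gA: "g x = f x" if "x \<in> univ A" for x using that unfolding g_def by simp
  have gA': "g ` e = f ` e" if "e \<subseteq> univ A" for e using that gA by (intro image_cong) auto
  \<comment> \<open>The copy of \<open>B\<close> meets \<open>C\<close> exactly in the copy of
    \<open>A\<close>.\<close>
  have gC: "g x \<in> univ C \<longleftrightarrow> x \<in> univ A" if "x \<in> univ B" for x
  proof (cases "x \<in> univ A")
    case True
    then show ?thesis using emb gA unfolding embedding_def by auto
  next
    case False
    then have "h x \<in> F" using that h bij_betwE by blast
    then show ?thesis using False F(3) unfolding g_def by auto
  qed
  have "inj_on g (univ A)" "inj_on g (univ B - univ A)"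
    using emb h unfolding embedding_def bij_betw_def by (auto simp: inj_on_def g_def)
  moreover have "g x \<noteq> g y" if "x \<in> univ A" "y \<in> univ B - univ A" for x y
    using gC[of x] gC[of y] that AB by auto
  ultimately have inj: "inj_on g (univ B)"
    unfolding inj_on_def by (metis Diff_iff)
  have ginj: "g ` b = g ` b' \<longleftrightarrow> b = b'" if "b \<subseteq> univ B" "b' \<subseteq> univ B" for b b'
    using that inj by (simp add: inj_on_image_eq_iff)
  define V where "V = univ C \<union> g ` univ B"
  define H where "H E = edges C E \<union> (`) g ` edges B E" for E
  have edgeB: "b \<subseteq> univ B" "card b = ar E" if "b \<in> edges B E" for b E
    using that uniB unfolding uniform_def by auto
  have edgeC: "b \<subseteq> univ C" "card b = ar E" if "b \<in> edges C E" for b E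
    using that uniC unfolding uniform_def by auto
  have inA: "b \<subseteq> univ A" if "b \<subseteq> univ B" "g ` b \<subseteq> univ C" for b
    using that gC by blast
  have iff: "b \<in> edges B E \<longleftrightarrow> g ` b \<in> edges C E" if "b \<subseteq> univ A" for b E
    using that embedding_edges_iff[OF emb that] gA'[OF that] edgesA by auto
  have "e \<subseteq> V \<and> card e = ar E" if "e \<in> H E" for e E
  proof (cases "e \<in> edges C E")
    case True
    then show ?thesis using edgeC[OF True] unfolding V_def by auto
  next
    case False
    then obtain b where "b \<in> edges B E" "e = g ` b"
      using \<open>e \<in> H E\<close> unfolding H_def by auto
    then show ?thesis
      using edgeB[of b E] card_image[OF inj_on_subset[OF inj]] unfolding V_def by auto
  qed
  then have uni: "uniform ar V H"
    unfolding uniform_def V_def using fin by simp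
  have ext: "extends (univ C) (edges C) V H" unfolding extends_def
  proof (intro conjI allI)
    show "univ C \<subseteq> V" unfolding V_def by simp
    fix E
    \<comment> \<open>An image edge inside \<open>C\<close> comes from an edge inside
      \<open>A\<close>, and there \<open>f\<close> is an embedding into \<open>C\<close>. So the
      amalgam has no new edge inside \<open>C\<close>.\<close>
    have "g ` b \<in> edges C E" if "b \<in> edges B E" "g ` b \<subseteq> univ C" for b
      using iff[OF inA[OF edgeB(1)[OF that(1)] that(2)]] that(1) by simp
    then show "edges C E = {e \<in> H E. e \<subseteq> univ C}" unfolding H_def using edgeC(1) by auto
  qed
  have gap: "gap \<alpha> H (univ C) V {} 0" unfolding gap_def
  proof (intro allI impI)
    fix X assume X: "univ C \<subseteq> X \<and> X \<subseteq> V \<and> {} \<subseteq> X"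
    define Y where "Y = {y \<in> univ B. g y \<in> X}"
    have Y: "univ A \<subseteq> Y" "Y \<subseteq> univ B" unfolding Y_def using AB gC X by auto
    have finY: "finite Y" using Y fin finite_subset by blast
    have finA: "finite (univ A)" using AB fin finite_subset by blast
    have "x \<in> univ C \<union> g ` (Y - univ A)" if "x \<in> X" for x
    proof (cases "x \<in> univ C")
      case False
      then obtain y where "y \<in> univ B" "x = g y" using \<open>x \<in> X\<close> X unfolding V_def by auto
      then show ?thesis using False gC[of y] \<open>x \<in> X\<close> unfolding Y_def by auto
    qed simp
    moreover have "univ C \<union> g ` (Y - univ A) \<subseteq> X" using X unfolding Y_def by auto
    ultimately have "X = univ C \<union> g ` (Y - univ A)" by blast
    moreover have "univ C \<inter> g ` (Y - univ A) = {}" using gC Y(2) by auto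
    moreover have "card (g ` (Y - univ A)) = card Y - card (univ A)"
      using card_image[OF inj_on_subset[OF inj]] Y finA by (metis Diff_subset card_Diff_subset order_trans)
    ultimately have "card X = card (univ C) + (card Y - card (univ A))"
      using fin finY by (simp add: card_Un_disjoint)
    then have cardX: "(of_nat (card X) :: rat) = of_nat (card (univ C)) + (of_nat (card Y) - of_nat (card (univ A)))"
      using card_mono[OF finY Y(1)] by (simp add: of_nat_diff)
    \<comment> \<open>Edges of \<open>B\<close> inside \<open>A\<close> are identified with edges of
      \<open>C\<close> and would be counted twice, hence the subtraction.\<close>
    have cardH: "(of_nat (card {e \<in> H E. e \<subseteq> X}) :: rat) = of_nat (card {e \<in> edges C E. e \<subseteq> univ C})
      + (of_nat (card {e \<in> edges B E. e \<subseteq> Y}) - of_nat (card {e \<in> edges B E. e \<subseteq> univ A}))" for E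
    proof -
      let ?S = "{e \<in> edges B E. e \<subseteq> Y}" and ?T = "{e \<in> edges B E. e \<subseteq> univ A}"
      have finS: "finite ?S" "finite ?T" and finC: "finite (edges C E)"
        using uniform_finite_edges[OF uniB] uniform_finite_edges[OF uniC] by simp_all
      have ST: "?T \<subseteq> ?S" using Y by auto
      have gb: "g ` b \<subseteq> X \<longleftrightarrow> b \<subseteq> Y" if "b \<in> edges B E" for b
        using edgeB(1)[OF that] unfolding Y_def by auto
      have old: "g ` b \<in> edges C E \<longleftrightarrow> b \<subseteq> univ A" if "b \<in> edges B E" for b
        using iff[of b E] inA[OF edgeB(1)[OF that]] edgeC(1)[of "g ` b" E] that by auto
      have CX: "e \<subseteq> X" if "e \<in> edges C E" for e using edgeC(1)[OF that] X by auto
      have "e \<in> edges C E \<union> (`) g ` (?S - ?T)" if "e \<in> H E" "e \<subseteq> X" for e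
      proof (cases "e \<in> edges C E")
        case False
        then obtain b where b: "b \<in> edges B E" "e = g ` b"
          using \<open>e \<in> H E\<close> unfolding H_def by auto
        then have "b \<in> ?S - ?T" using gb[OF b(1)] old[OF b(1)] \<open>e \<subseteq> X\<close> False by simp
        then show ?thesis using b(2) by blast
      qed simp
      moreover have "e \<in> H E \<and> e \<subseteq> X" if "e \<in> edges C E \<union> (`) g ` (?S - ?T)" for e
        using that CX gb unfolding H_def by auto
      ultimately have "{e \<in> H E. e \<subseteq> X} = edges C E \<union> (`) g ` (?S - ?T)"
        by blast
      moreover have "card (edges C E \<union> (`) g ` (?S - ?T)) = card (edges C E) + card ((`) g ` (?S - ?T))"
        using finC finS old by (intro card_Un_disjoint) auto
      moreover have "inj_on ((`) g) (?S - ?T)"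
        using ginj edgeB(1) by (intro inj_onI) auto
      then have "card ((`) g ` (?S - ?T)) = card (?S - ?T)" by (rule card_image)
      moreover have "card (?S - ?T) = card ?S - card ?T" using finS ST by (intro card_Diff_subset)
      ultimately have "card {e \<in> H E. e \<subseteq> X} = card (edges C E) + (card ?S - card ?T)" by simp
      moreover have "{e \<in> edges C E. e \<subseteq> univ C} = edges C E" using edgeC(1) by auto
      ultimately show ?thesis using card_mono[OF finS(1) ST] by (simp add: of_nat_diff)
    qed
    have "predim \<alpha> H X = predim \<alpha> (edges C) (univ C)
        + (predim \<alpha> (edges B) Y - predim \<alpha> (edges B) (univ A))"
      unfolding predim_def cardX cardH
      by (simp add: distrib_left right_diff_distrib sum.distrib sum_subtractf)
    moreover have "predim \<alpha> (edges B) (univ A) + 0 \<le> predim \<alpha> (edges B) Y"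
      using gapD[OF strong[unfolded strong_iff_gap[OF sub]] Y] by simp
    moreover have "predim \<alpha> H (univ C) = predim \<alpha> (edges C) (univ C)"
      using predim_extends[OF ext] by blast
    ultimately show "predim \<alpha> H (univ C) + 0 \<le> predim \<alpha> H X" by simp
  qed
  have "embedding g B (of_hypergraph V H)"
  proof (rule embedding_of_edges[OF B of_hypergraph_K_L[OF uni] inj])
    show "g ` univ B \<subseteq> univ (of_hypergraph V H)" unfolding V_def by simp
    fix E e assume e: "e \<subseteq> univ B"
    have "e \<in> edges B E" if "g ` e \<in> edges C E"
      using iff[OF inA[OF e edgeC(1)[OF that]]] that by simp
    moreover have "e \<in> edges B E" if "g ` e \<in> (`) g ` edges B E"
      using that ginj[OF e edgeB(1)] by auto
    ultimately show "e \<in> edges B E \<longleftrightarrow> g ` e \<in> edges (of_hypergraph V H) E"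
      unfolding edges_of_hypergraph[OF uni] H_def by blast
  qed
  then show thesis using that[OF uni ext gap] gA by simp
qed

subsection \<open>The generic structure\<close>

lemma generic_embeds_strong_extension:
  fixes A B M :: "('a::infinite, 'l::finite) fo_structure"
  assumes "sparse_weights ar \<alpha>" and gen: "generic ar \<alpha> k M"
    and A: "A \<in> K_\<alpha> ar \<alpha>" and B: "B \<in> K_\<alpha> ar \<alpha>" and strong: "strong \<alpha> A B"
    and emb: "embedding f A M"
  shows "\<exists>g. embedding g B M \<and> (\<forall>x\<in>univ A. g x = f x)"
proof -
  interpret sparse_weights ar \<alpha> by fact
  have K_L: "A \<in> K_L ar" "B \<in> K_L ar" using A B unfolding K_\<alpha>_def by auto
  have "f ` univ A \<subseteq> univ M" using emb unfolding embedding_def by blast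
  then have sub: "substructure (induced M (f ` univ A)) M" by (rule substructure_induced)
  moreover have "finite (f ` univ A)" using K_L(1) unfolding K_L_def by simp
  ultimately obtain C where C: "C \<in> K_frac ar \<alpha> k" "substructure (induced M (f ` univ A)) C"
    "strong_in \<alpha> C M"
    using gen unfolding generic_def by (metis univ_induced)
  have CM: "substructure C M" using C(3) unfolding strong_in_def by blast
  have C_K: "C \<in> K_\<alpha> ar \<alpha>" and \<delta>C: "\<delta> \<alpha> C = of_nat k / of_int (common_denom \<alpha>)"
    using C(1) unfolding K_frac_def by auto
  then have C_K_L: "C \<in> K_L ar" unfolding K_\<alpha>_def by blast
  have "embedding f A C"
    using embedding_into[OF emb CM] C(2) unfolding substructure_def by simp
  then obtain V H g where V: "uniform ar V H" "extends (univ C) (edges C) V H"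
      "gap \<alpha> H (univ C) V {} 0"
    and g: "embedding g B (of_hypergraph V H)" "\<And>x. x \<in> univ A \<Longrightarrow> g x = f x"
    using free_amalgam[OF K_L(2) C_K_L strong] by blast
  have "univ C \<subseteq> V" using V(2) unfolding extends_def by blast
  then obtain V' H' where V': "uniform ar V' H'" "extends V H V' H'" "gap \<alpha> H' (univ C) V' {} 0"
    "predim \<alpha> H' V' = predim \<alpha> H (univ C)"
    using extend_to_predim[OF V(1) _ V(3)] by blast
  define D where "D = of_hypergraph V' H'"
  have edgesD: "edges D = H'" and D_K_L: "D \<in> K_L ar" and univD: "univ D = V'"
    unfolding D_def using edges_of_hypergraph[OF V'(1)] of_hypergraph_K_L[OF V'(1)] by auto
  have finV': "finite V'" using V'(1) unfolding uniform_def by blast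
  have ext: "extends (univ C) (edges C) V' H'" using V(2) V'(2) by (rule extends_trans)
  have CD: "substructure C D" unfolding substructure_def
  proof (intro conjI allI)
    show "univ C \<subseteq> univ D" using ext unfolding extends_def univD by blast
    have "t \<in> rel C E \<longleftrightarrow> t \<in> rel D E \<and> set t \<subseteq> univ C" for t E
      using ext K_L_rel_iff[OF C_K_L] K_L_rel_iff[OF D_K_L] unfolding extends_def edgesD by auto
    then show "rel C E = {t \<in> rel D E. set t \<subseteq> univ C}" for E by blast
  qed
  have strongD: "strong \<alpha> C D"
    unfolding strong_iff_gap[OF CD] edgesD univD by (rule V'(3))
  \<comment> \<open>Submodularity with \<open>C\<close>: since \<open>C\<close> is strong in
    \<open>D\<close>, the value at \<open>X\<close> is at least the value at the intersection of
    \<open>X\<close> with \<open>C\<close>, which is nonnegative because \<open>C\<close> is in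
    \<open>K_\<alpha>\<close>.\<close>
  have "0 \<le> predim \<alpha> (edges D) X" if X: "X \<subseteq> univ D" for X
  proof -
    have fin: "finite X" "finite (univ C)"
      using X finV' C_K_L finite_subset unfolding univD K_L_def by blast+
    have "predim \<alpha> H' (X \<union> univ C) + predim \<alpha> H' (X \<inter> univ C) \<le> predim \<alpha> H' X + predim \<alpha> H' (univ C)"
      using fin weight_pos by (intro predim_submodular) (auto intro: less_imp_le)
    moreover have "predim \<alpha> H' (univ C) + 0 \<le> predim \<alpha> H' (X \<union> univ C)"
      using X ext unfolding univD extends_def by (intro gapD[OF V'(3)]) auto
    moreover have "0 \<le> predim \<alpha> H' (X \<inter> univ C)"
      using C_K predim_extends[OF ext, of "X \<inter> univ C" \<alpha>] unfolding K_\<alpha>_iff by simp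
    ultimately show ?thesis unfolding edgesD by simp
  qed
  then have "D \<in> K_\<alpha> ar \<alpha>" unfolding K_\<alpha>_iff using D_K_L by blast
  \<comment> \<open>This equality is the reason for lowering the predimension: it puts
    \<open>D\<close> into the same class \<open>K_frac\<close> as \<open>C\<close>, where the
    extension property of the generic structure is available.\<close>
  moreover have "\<delta> \<alpha> D = \<delta> \<alpha> C"
    using V'(4) predim_extends[OF V(2), of "univ C" \<alpha>] unfolding \<delta>_eq_predim edgesD univD by simp
  ultimately have "D \<in> K_frac ar \<alpha> k" unfolding K_frac_def using \<delta>C by simp
  then obtain B' where B': "strong_in \<alpha> B' M" "isomorphic_over C D B'"
    using gen C(1,3) strongD unfolding generic_def by blast
  then obtain h where h: "embedding h D B'" "\<And>x. x \<in> univ C \<Longrightarrow> h x = x"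
    unfolding isomorphic_over_def by blast
  have "substructure B' M" using B'(1) unfolding strong_in_def by blast
  then have hM: "embedding h D M" by (rule embedding_mono[OF h(1)])
  have "substructure (of_hypergraph V H) D"
    using V(1) V'(2) unfolding substructure_def D_def extends_def uniform_def by auto
  then have "embedding g B D" by (rule embedding_mono[OF g(1)])
  then have "embedding (h \<circ> g) B M" using hM by (rule embedding_comp)
  \<comment> \<open>On \<open>A\<close> the map \<open>g\<close> agrees with \<open>f\<close> and
    has values in \<open>C\<close>, which \<open>h\<close> fixes pointwise.\<close>
  moreover have "(h \<circ> g) x = f x" if "x \<in> univ A" for x
    using that g(2) h(2) C(2) unfolding substructure_def by auto
  ultimately show ?thesis by blast
qed

section \<open>The dimension\<close>

text \<open>A finite \<open>A\<close> strong in \<open>M\<close> lies in some \<open>B\<close> of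
  predimension k/c inside \<open>M\<close>. Then \<open>A\<close> is strong in \<open>B\<close>, so
  \<delta>(A) is at most \<delta>(B). Thus k/c bounds all values, and it is attained.\<close>

lemma generic_dim:
  assumes gen: "generic ar \<alpha> k M"
  shows "structure_dim \<alpha> M = ereal (of_nat k / of_int (common_denom \<alpha>))"
proof -
  define D where "D = {\<delta> \<alpha> B |B. strong_in \<alpha> B M}"
  define d :: rat where "d = of_nat k / of_int (common_denom \<alpha>)"
  have cover: "\<exists>B\<in>K_frac ar \<alpha> k. substructure A B \<and> strong_in \<alpha> B M"
    if "finite (univ A)" "substructure A M" for A
    using gen that unfolding generic_def by blast
  \<comment> \<open>Covering the empty substructure provides a strong finite substructure that
    attains the value k/c.\<close>
  obtain B where "B \<in> K_frac ar \<alpha> k" "strong_in \<alpha> B M"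
    using cover[of "induced M {}"] substructure_induced[of "{}" M] by auto
  then have dD: "d \<in> D" unfolding D_def d_def K_frac_def by force
  have le: "e \<le> d" if "e \<in> D" for e
  proof -
    obtain A where A: "strong_in \<alpha> A M" "e = \<delta> \<alpha> A" using \<open>e \<in> D\<close> unfolding D_def by blast
    then obtain B where B: "B \<in> K_frac ar \<alpha> k" "substructure A B" "strong_in \<alpha> B M"
      using cover unfolding strong_in_def by blast
    then have "strong \<alpha> A B" using A(1) unfolding strong_in_def by blast
    moreover have "substructure B B"
      using B(1) unfolding substructure_def K_frac_def K_\<alpha>_def K_L_def is_structure_def by auto
    ultimately have "\<delta> \<alpha> A \<le> \<delta> \<alpha> B" using B(2) unfolding strong_def by blast
    then show ?thesis using B(1) A(2) unfolding K_frac_def d_def by simp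
  qed
  have "bdd_above D" using le by (rule bdd_aboveI)
  moreover have "(GREATEST e. e \<in> D) = d" using dD le by (rule Greatest_equality)
  ultimately have "structure_dim \<alpha> M = ereal (of_rat d)"
    unfolding structure_dim_def D_def[symmetric] by simp
  then show ?thesis unfolding d_def by (simp add: of_rat_divide)
qed

theorem theorem4p5:
  fixes ar :: "'l::finite \<Rightarrow> nat"
    and \<alpha> :: "'l \<Rightarrow> rat"
    and k :: nat
    and M :: "('a::infinite, 'l) fo_structure"
  assumes "\<And>E. 2 \<le> ar E"
    and "\<And>E. 0 < \<alpha> E \<and> \<alpha> E < 1"
    and "generic ar \<alpha> k M"
  shows "models_S ar \<alpha> M \<and> structure_dim \<alpha> M = ereal (of_nat k / of_int (common_denom \<alpha>))"
proof
  have "sparse_weights ar \<alpha>" using assms(1,2) by unfold_locales auto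
  then have "\<exists>g. embedding g B M \<and> (\<forall>x\<in>univ A. g x = f x)"
    if "A \<in> K_\<alpha> ar \<alpha>" "B \<in> K_\<alpha> ar \<alpha>" "strong \<alpha> A B" "embedding f A M"
    for A B :: "('a, 'l) fo_structure" and f
    using assms(3) that by (rule generic_embeds_strong_extension)
  moreover have "is_structure ar M \<and> (\<forall>A. finite (univ A) \<and> substructure A M \<longrightarrow> A \<in> K_\<alpha> ar \<alpha>)"
    using assms(3) unfolding generic_def by simp
  ultimately show "models_S ar \<alpha> M"
    unfolding models_S_def by simp
qed (rule generic_dim[OF assms(3)])

end
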